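(* Consider, for $N\in\mathbb{N}$, the stationary Dirichlet problem $$u_{xx}+f(x,u,\omega)+F=0 \ \text{ in } [-N+\delta,N-\delta],\qquad u(-N+\delta)=u(N-\delta)=0,$$ with the random field $f$ and driving field $F>0$ described in the context. There exist constants $F_0>0$, $C>0$ and $K>0$ such that for every $F>F_0$ and every sufficiently large $N$ the following holds: if $u(\cdot,\omega)$ is a nonnegative solution of this problem (depending measurably on $\omega$), then $$\mathbb{P}\Big(\big\{\omega:\ u(x,\omega)\ge \big(K(N-1)-K|x|\big)_+ \text{ for all } x\in[-N+\delta,N-\delta]\big\}\Big)\ge 1-Ce^{-N/C},$$ where $a_+=\max\{a,0\}$.
   Context: Fix $\delta$ with $0<\delta\ll 1/2$ and $\lambda_0>0$. Let $\mathbb{Z}^*=\mathbb{Z}+\tfrac12$ and $b_{i,j}=(i,j)$ for $(i,j)\in\mathbb{Z}\times\mathbb{Z}^*$. Let $\phi\in C_c^\infty(\mathbb{R}^2)$ be nonnegative with support in $[-\delta,\delta]^2$, and put $\phi_{i,j}(x,s)=\phi((x,s)-b_{i,j})$. Let $(l(i,j))_{(i,j)\in\mathbb{Z}\times\mathbb{Z}^*}$ be i.i.d. exponential random variables on a probability space $(\Omega,\mathcal{F},\mathbb{P})$ with $\mathbb{P}(l(i,j)>r)=e^{-\lambda_0 r}$ for $r\ge0$. The random field is $f(x,s,\omega)=g(x,s)-\sum_{(i,j)\in\mathbb{Z}\times\mathbb{Z}^*} l(i,j)(\omega)\phi_{i,j}(x,s)$, where $g$ is a nonnegative $C^1$ function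 on $\mathbb{R}^2$ such that $\lim_{L\to\infty}(2L)^{-2}\int_{[-L,L]^2}f(x,s)\,dx\,ds=0$. $F>0$ is a constant. *)

theory Defs
  imports "HOL-Probability.Probability"
begin

text \<open>C-infinity smoothness of a function on the plane (real * real): there is a family
  of functions containing the given one, closed under taking both partial derivatives,
  each member being continuous and (Frechet) differentiable with partial derivatives
  again in the family.\<close>
definition smooth2 :: "(real \<times> real \<Rightarrow> real) \<Rightarrow> bool" where
  "smooth2 h \<longleftrightarrow> (\<exists>S. h \<in> S \<and> (\<forall>k\<in>S. continuous_on UNIV k \<and>
      (\<exists>kx\<in>S. \<exists>ky\<in>S. \<forall>p. (k has_derivative (\<lambda>(a, b). a * kx p + b * ky p)) (at p))))"

definition C1_plane :: "(real \<times> real \<Rightarrow> real) \<Rightarrow> bool" where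
  "C1_plane h \<longleftrightarrow> (\<exists>D :: real \<times> real \<Rightarrow> ((real \<times> real) \<Rightarrow>\<^sub>L real).
      (\<forall>p. (h has_derivative blinfun_apply (D p)) (at p)) \<and> continuous_on UNIV D)"

text \<open>The random field f(x,s,omega) = g(x,s) - sum over (i,j) in Z x Z* of l(i,j) phi((x,s) - (i,j)).
  The index j in Z* = Z + 1/2 is encoded as j' + 1/2 with j' an integer.\<close>
definition rfield ::
  "(real \<times> real \<Rightarrow> real) \<Rightarrow> (real \<times> real \<Rightarrow> real) \<Rightarrow> (int \<times> int \<Rightarrow> 'w \<Rightarrow> real)
     \<Rightarrow> real \<Rightarrow> real \<Rightarrow> 'w \<Rightarrow> real" where
  "rfield g \<phi> l x s \<omega> = g (x, s) -
     (\<Sum>\<^sub>\<infinity>ij\<in>UNIV. l ij \<omega> * \<phi> (x - real_of_int (fst ij), s - (real_of_int (snd ij) + 1/2)))"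

definition dirichlet_sol :: "(real \<Rightarrow> real \<Rightarrow> real) \<Rightarrow> real \<Rightarrow> real \<Rightarrow> real \<Rightarrow> (real \<Rightarrow> real) \<Rightarrow> bool" where
  "dirichlet_sol h F a b v \<longleftrightarrow> continuous_on {a..b} v \<and> v a = 0 \<and> v b = 0 \<and>
     (\<exists>v' v''. \<forall>x\<in>{a<..<b}. (v has_real_derivative v' x) (at x) \<and>
        (v' has_real_derivative v'' x) (at x) \<and> v'' x + h x (v x) + F = 0)"

end

theory Submission
  imports Defs
begin

text \<open>Write \<open>f = u'\<close>, so that \<open>f' = -F - g + w\<close> with \<open>w\<close> the obstacle force seen by the
  solution. If \<open>u\<close> lies below the tent \<open>N - 1 - \<bar>x\<bar>\<close> at some \<open>x0\<close>, testing the equation against the hat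
  function with peak \<open>x0\<close> shows that the total force \<open>B = \<integral> w\<close> along \<open>u\<close> is at least \<open>F N / 8\<close>.

  Such a \<open>B\<close> is exponentially unlikely for large \<open>F\<close>, by a union bound over discretised paths: in
  each column one records only the jump to, and the number of, the obstacles responsible for \<open>w\<close>.
  Recording a jump costs a logarithmic entropy, and slopes may be of order \<open>N\<close>, so a naive count loses a
  factor \<open>log N\<close> per column. It is regained column by column. If \<open>\<bar>f\<bar>\<close> is large and nearly constant,
  every strip is crossed in time \<open>O(1 / \<bar>f\<bar>)\<close>; then either the column contributes a bounded force, and
  nothing is recorded, or the sum of about \<open>\<bar>f\<bar>\<close> exponential variables is atypically large, which
  pays for the entropy. Otherwise \<open>\<bar>f\<bar>\<close> is bounded by a constant plus its variation \<open>T\<close> over the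
  column, the strongest obstacle met by \<open>u\<close> suffices, and the entropy \<open>log (1 + T)\<close> is absorbed
  because the total variation of \<open>f\<close> is at most a multiple of \<open>B\<close>.\<close>

section \<open>Exponential moments of discretised paths\<close>

text \<open>Weight of entering column \<open>i\<close> at level \<open>h'\<close>, coming from level \<open>h\<close>, and recording the \<open>r\<close>
  obstacles upwards from \<open>h'\<close>. The factor \<open>4 ^ r\<close> dominates the exponential moment \<open>2 ^ r\<close> at
  \<open>\<theta> = lambda0 / 2\<close>, and the squared factor makes the sum over jumps converge; \<open>h' = h\<close>, \<open>r = 0\<close> has
  weight \<open>1\<close>, so columns can be skipped for free.\<close>
definition step_weight :: "(int \<times> int \<Rightarrow> real) \<Rightarrow> real \<Rightarrow> int \<Rightarrow> int \<Rightarrow> int \<Rightarrow> nat \<Rightarrow> real" where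
  "step_weight L \<theta> i h h' r =
     exp (\<theta> * (\<Sum>j\<in>{h'..<h' + int r}. L (i, j))) / (4 ^ r * (1 + real (int_encode (h' - h)))\<^sup>2)"

text \<open>The partition function of directed paths through \<open>n\<close> successive columns.
  Coding jumps by naturals turns the sum over levels into a series, and in \<open>ennreal\<close> no
  convergence has to be checked.\<close>

primrec path_sum :: "(int \<times> int \<Rightarrow> real) \<Rightarrow> real \<Rightarrow> nat \<Rightarrow> int \<Rightarrow> int \<Rightarrow> ennreal" where
  "path_sum L \<theta> 0 i h = 1"
| "path_sum L \<theta> (Suc n) i h =
     (\<Sum>m. \<Sum>r. ennreal (step_weight L \<theta> i h (h + int_decode m) r) *
                path_sum L \<theta> n (i + 1) (h + int_decode m))"

lemma ennreal_le_suminf: "f k \<le> (\<Sum>n. f n)" for f :: "nat \<Rightarrow> ennreal"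
  using sum_le_suminf[of f "{k}"] by auto

text \<open>One term of a nonnegative double series. Iterated, it bounds the path sum below by the
  weight of any single recorded path, which is how the union bound enters.\<close>

lemma path_sum_step:
  "ennreal (step_weight L \<theta> i h h' r) * path_sum L \<theta> n (i + 1) h' \<le> path_sum L \<theta> (Suc n) i h"
proof -
  define m where "m = int_encode (h' - h)"
  have h': "h' = h + int_decode m" by (simp add: m_def)
  have "ennreal (step_weight L \<theta> i h h' r) * path_sum L \<theta> n (i + 1) h'
      \<le> (\<Sum>r. ennreal (step_weight L \<theta> i h h' r) * path_sum L \<theta> n (i + 1) h')"
    by (rule ennreal_le_suminf)
  also have "\<dots> \<le> path_sum L \<theta> (Suc n) i h"
    unfolding path_sum.simps(2) h'
    by (rule ennreal_le_suminf[of "\<lambda>m. \<Sum>r. ennreal (step_weight L \<theta> i h (h + int_decode m) r) *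
                path_sum L \<theta> n (i + 1) (h + int_decode m)" m])
  finally show ?thesis .
qed

lemma step_weight_nonneg: "0 \<le> step_weight L \<theta> i h h' r"
  by (simp add: step_weight_def)

text \<open>The total mass of the jump factors of one step, that is,
  \<open>pi^2 / 6\<close>.\<close>

definition inverse_square_sum :: real where
  "inverse_square_sum = (\<Sum>m. 1 / (1 + real m)\<^sup>2)"

lemma suminf_inverse_square:
  "(\<Sum>m. ennreal (1 / (1 + real m)\<^sup>2)) = ennreal inverse_square_sum"
  and inverse_square_sum_ge_1: "1 \<le> inverse_square_sum"
proof -
  have s: "summable (\<lambda>m. 1 / (1 + real m)\<^sup>2)"
    using iffD2[OF summable_Suc_iff inverse_power_summable[of 2, where ?'a = real]]
    by (simp add: inverse_eq_divide)
  show "(\<Sum>m. ennreal (1 / (1 + real m)\<^sup>2)) = ennreal inverse_square_sum"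
    unfolding inverse_square_sum_def by (rule suminf_ennreal_eq) (use s in \<open>auto intro: summable_sums\<close>)
  show "1 \<le> inverse_square_sum"
    unfolding inverse_square_sum_def using sum_le_suminf[OF s, of "{0}"] by simp
qed

section \<open>Expectation and tail of the path sum for independent exponential obstacles\<close>

context prob_space begin

text \<open>Tilting the density of rate \<open>lam\<close> by \<open>exp (lam / 2 * x)\<close> gives
  twice the density of rate \<open>lam / 2\<close>.\<close>

lemma exponential_exp_moment:
  assumes "0 < lam" and D: "distributed M lborel X (exponential_density lam)"
  shows "(\<integral>\<^sup>+\<omega>. ennreal (exp (lam / 2 * X \<omega>)) \<partial>M) = 2"
proof -
  have "(\<integral>\<^sup>+\<omega>. ennreal (exp (lam / 2 * X \<omega>)) \<partial>M)
      = (\<integral>\<^sup>+x. ennreal (exponential_density lam x) * ennreal (exp (lam / 2 * x)) \<partial>lborel)"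
    by (subst distributed_nn_integral[OF D]) auto
  also have "\<dots> = (\<integral>\<^sup>+x. 2 * ennreal (exponential_density (lam / 2) x) \<partial>lborel)"
  proof (rule nn_integral_cong)
    fix x :: real
    have "exponential_density lam x * exp (lam / 2 * x) = 2 * exponential_density (lam / 2) x"
      by (auto simp: exponential_density_def mult_exp_exp algebra_simps)
    then show "ennreal (exponential_density lam x) * ennreal (exp (lam / 2 * x))
        = 2 * ennreal (exponential_density (lam / 2) x)"
      using assms(1) exponential_density_nonneg[of lam x] exponential_density_nonneg[of "lam / 2" x]
      by (simp add: ennreal_mult[symmetric] flip: ennreal_numeral)
  qed
  also have "\<dots> = 2 * (\<integral>\<^sup>+x. ennreal (exponential_density (lam / 2) x) \<partial>lborel)"
    by (rule nn_integral_cmult) simp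
  also have "(\<integral>\<^sup>+x. ennreal (exponential_density (lam / 2) x) \<partial>lborel) = 1"
    using nn_integral_erlang_ith_moment[of "lam/2" 0 0] assms by simp
  finally show ?thesis by simp
qed

lemma exp_moment_sum:
  fixes l :: "'i \<Rightarrow> 'a \<Rightarrow> real"
  assumes "0 < lam" and ind: "indep_vars (\<lambda>_. borel) l UNIV"
    and D: "\<And>k. distributed M lborel (l k) (exponential_density lam)" and "finite S"
  shows "(\<integral>\<^sup>+\<omega>. ennreal (exp (lam / 2 * (\<Sum>k\<in>S. l k \<omega>))) \<partial>M) = 2 ^ card S"
proof -
  have "(\<integral>\<^sup>+\<omega>. ennreal (exp (lam / 2 * (\<Sum>k\<in>S. l k \<omega>))) \<partial>M)
      = (\<integral>\<^sup>+\<omega>. (\<Prod>k\<in>S. ennreal (exp (lam / 2 * l k \<omega>))) \<partial>M)"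
    by (simp add: prod_ennreal sum_distrib_left exp_sum \<open>finite S\<close>)
  also have "\<dots> = (\<Prod>k\<in>S. \<integral>\<^sup>+\<omega>. ennreal (exp (lam / 2 * l k \<omega>)) \<partial>M)"
  proof (rule indep_vars_nn_integral[OF \<open>finite S\<close>])
    show "indep_vars (\<lambda>_. borel) (\<lambda>k \<omega>. ennreal (exp (lam / 2 * l k \<omega>))) S"
      using indep_vars_compose2[OF indep_vars_subset[OF ind], of S "\<lambda>_ x. ennreal (exp (lam / 2 * x))" "\<lambda>_. borel"]
      by auto
  qed auto
  also have "\<dots> = 2 ^ card S"
    using exponential_exp_moment[OF \<open>0 < lam\<close> D] by simp
  finally show ?thesis .
qed

lemma path_sum_measurable:
  assumes [measurable]: "\<And>k. l k \<in> borel_measurable M"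
  shows "(\<lambda>\<omega>. path_sum (\<lambda>k. l k \<omega>) \<theta> n i h) \<in> borel_measurable M"
proof (induction n arbitrary: i h)
  case (Suc n)
  note [measurable] = Suc
  show ?case unfolding path_sum.simps step_weight_def by measurable
qed simp

text \<open>The set \<open>S\<close> accumulates the sites of the columns already visited; the walk only moves to
  fresh columns, so no site is counted twice.\<close>
lemma path_sum_expectation:
  fixes l :: "int \<times> int \<Rightarrow> 'a \<Rightarrow> real"
  assumes "0 < lam" and ind: "indep_vars (\<lambda>_. borel) l UNIV"
    and D: "\<And>k. distributed M lborel (l k) (exponential_density lam)"
    and "finite S" and "\<And>k. k \<in> S \<Longrightarrow> fst k < i"
  shows "(\<integral>\<^sup>+\<omega>. ennreal (exp (lam / 2 * (\<Sum>k\<in>S. l k \<omega>))) * path_sum (\<lambda>k. l k \<omega>) (lam / 2) n i h \<partial>M)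
    = 2 ^ card S * ennreal (2 * inverse_square_sum) ^ n"
  using assms(4,5)
proof (induction n arbitrary: S i h)
  case 0
  then show ?case using exp_moment_sum[OF assms(1) ind D] by simp
next
  case (Suc n)
  have lm[measurable]: "l k \<in> borel_measurable M" for k
    using D[of k] by (auto simp: distributed_def)
  note [measurable] = path_sum_measurable[OF lm]
  define I where "I = (\<lambda>m r \<omega>. ennreal (exp (lam / 2 * (\<Sum>k\<in>S. l k \<omega>))) *
      (ennreal (step_weight (\<lambda>k. l k \<omega>) (lam / 2) i h (h + int_decode m) r) *
       path_sum (\<lambda>k. l k \<omega>) (lam / 2) n (i + 1) (h + int_decode m)))"
  have [measurable]: "I m r \<in> borel_measurable M" for m r
    unfolding I_def step_weight_def by measurable
  have I: "(\<integral>\<^sup>+\<omega>. I m r \<omega> \<partial>M) =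
      2 ^ card S * ennreal (2 * inverse_square_sum) ^ n * (ennreal (1 / (1 + real m)\<^sup>2) * ennreal ((1/2) ^ r))"
    for m r
  proof -
    define h' where "h' = h + int_decode m"
    \<comment> \<open>The newly recorded sites lie in column \<open>i\<close>, hence outside
      \<open>S\<close>, and \<open>S \<union> R\<close> is an admissible set for the induction
      hypothesis at column \<open>i + 1\<close>.\<close>
    define R where "R = Pair i ` {h'..<h' + int r}"
    have R: "finite R" "S \<inter> R = {}" "card R = r" using Suc.prems(2) by (force simp: R_def card_image inj_on_def)+
    have sR: "(\<Sum>j\<in>{h'..<h' + int r}. l (i, j) \<omega>) = (\<Sum>k\<in>R. l k \<omega>)" for \<omega>
      unfolding R_def by (simp add: sum.reindex inj_on_def)
    have m: "int_encode (h' - h) = m" by (simp add: h'_def)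
    define a b where "a = (\<lambda>\<omega>. \<Sum>k\<in>S. l k \<omega>)" and "b = (\<lambda>\<omega>. \<Sum>k\<in>R. l k \<omega>)"
    have ab: "(\<Sum>k\<in>S \<union> R. l k \<omega>) = a \<omega> + b \<omega>" for \<omega>
      unfolding a_def b_def using R Suc.prems(1) by (intro sum.union_disjoint) auto
    have fold: "(\<Sum>k\<in>S. l k \<omega>) = a \<omega>" "(\<Sum>k\<in>R. l k \<omega>) = b \<omega>" for \<omega> by (auto simp: a_def b_def)
    define c where "c = 1 / (4 ^ r * (1 + real m)\<^sup>2)"
    have I_eq: "I m r \<omega> = ennreal c *
        (ennreal (exp (lam / 2 * (\<Sum>k\<in>S \<union> R. l k \<omega>))) * path_sum (\<lambda>k. l k \<omega>) (lam / 2) n (i + 1) h')" for \<omega>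
    proof -
      have "exp (lam / 2 * a \<omega>) * (exp (lam / 2 * b \<omega>) / (4 ^ r * (1 + real m)\<^sup>2)) =
          c * exp (lam / 2 * (a \<omega> + b \<omega>))"
        by (simp add: c_def distrib_left exp_add)
      then have "ennreal (exp (lam / 2 * a \<omega>)) * ennreal (exp (lam / 2 * b \<omega>) / (4 ^ r * (1 + real m)\<^sup>2)) =
          ennreal c * ennreal (exp (lam / 2 * (a \<omega> + b \<omega>)))"
        by (simp add: c_def flip: ennreal_mult)
      then show ?thesis
        unfolding I_def h'_def[symmetric] step_weight_def m sR ab fold
        by (simp add: mult.assoc[symmetric])
    qed
    have "(\<integral>\<^sup>+\<omega>. I m r \<omega> \<partial>M) = ennreal c * (\<integral>\<^sup>+\<omega>.
        ennreal (exp (lam / 2 * (\<Sum>k\<in>S \<union> R. l k \<omega>))) * path_sum (\<lambda>k. l k \<omega>) (lam / 2) n (i + 1) h' \<partial>M)"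
      unfolding I_eq by (rule nn_integral_cmult) measurable
    also have "\<dots> = ennreal c * (2 ^ card (S \<union> R) * ennreal (2 * inverse_square_sum) ^ n)"
      by (subst Suc.IH) (use Suc.prems R(1) in \<open>force simp: R_def\<close>)+
    also have "card (S \<union> R) = card S + r" using R Suc.prems by (simp add: card_Un_disjoint)
    \<comment> \<open>The factor \<open>1 / 4 ^ r\<close> is split in two: one half cancels the
      moment \<open>2 ^ r\<close> of the new sites, the other leaves a geometric series in
      \<open>r\<close>.\<close>
    also have "ennreal c = ennreal (1 / (1 + real m)\<^sup>2) * ennreal ((1/2) ^ r) * ennreal ((1/2) ^ r)"
    proof -
      have "(1/2) ^ r * (1/2 :: real) ^ r = 1 / 4 ^ r"
        by (simp add: power_divide flip: power_mult_distrib)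
      then have "c = 1 / (1 + real m)\<^sup>2 * ((1/2) ^ r * (1/2) ^ r)" by (simp add: c_def)
      then show ?thesis by (simp only: mult.assoc) (subst ennreal_mult | simp)+
    qed
    finally have "(\<integral>\<^sup>+\<omega>. I m r \<omega> \<partial>M) = (ennreal ((1/2)^r) * 2 ^ r) * (2 ^ card S * ennreal (2 * inverse_square_sum) ^ n *
        (ennreal (1 / (1 + real m)\<^sup>2) * ennreal ((1/2) ^ r)))"
      by (simp add: power_add ac_simps)
    also have "ennreal ((1/2)^r) * 2 ^ r = 1"
    proof -
      have "ennreal ((1/2)^r) * ennreal (2 ^ r) = ennreal ((1/2)^r * 2^r)" by (rule ennreal_mult[symmetric]) auto
      then show ?thesis by (simp add: ennreal_power[symmetric] power_divide)
    qed
    finally show ?thesis by simp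
  qed
  have geo: "(\<Sum>r. ennreal ((1/2) ^ r)) = 2"
  proof -
    have "(\<Sum>r. ennreal ((1/2) ^ r)) = ennreal 2"
      by (rule suminf_ennreal_eq) (use geometric_sums[of "1/2 :: real"] in auto)
    then show ?thesis by simp
  qed
  have "(\<integral>\<^sup>+\<omega>. ennreal (exp (lam / 2 * (\<Sum>k\<in>S. l k \<omega>))) * path_sum (\<lambda>k. l k \<omega>) (lam / 2) (Suc n) i h \<partial>M)
     = (\<integral>\<^sup>+\<omega>. (\<Sum>m. \<Sum>r. I m r \<omega>) \<partial>M)"
    by (simp add: I_def)
  also have "\<dots> = (\<Sum>m. \<Sum>r. \<integral>\<^sup>+\<omega>. I m r \<omega> \<partial>M)"
    by (subst nn_integral_suminf, measurable, subst nn_integral_suminf) auto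
  also have "\<dots> = 2 ^ card S * ennreal (2 * inverse_square_sum) ^ n * ((\<Sum>m. ennreal (1 / (1 + real m)\<^sup>2)) * 2)"
    unfolding I by (simp add: geo)
  also have "\<dots> = 2 ^ card S * ennreal (2 * inverse_square_sum) ^ Suc n"
    using inverse_square_sum_ge_1
    by (simp add: suminf_inverse_square ennreal_mult ac_simps)
  finally show ?case .
qed

text \<open>Markov's inequality, with the expectation computed from the empty set of visited
  sites.\<close>

lemma path_sum_tail:
  fixes l :: "int \<times> int \<Rightarrow> 'a \<Rightarrow> real"
  assumes "0 < lam" and ind: "indep_vars (\<lambda>_. borel) l UNIV"
    and D: "\<And>k. distributed M lborel (l k) (exponential_density lam)"
  shows "prob {\<omega> \<in> space M. ennreal (exp z) \<le> path_sum (\<lambda>k. l k \<omega>) (lam / 2) n i h}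
    \<le> exp (- z) * (2 * inverse_square_sum) ^ n"
proof -
  have lm[measurable]: "l k \<in> borel_measurable M" for k
    using D[of k] by (auto simp: distributed_def)
  note [measurable] = path_sum_measurable[OF lm]
  let ?Y = "\<lambda>\<omega>. path_sum (\<lambda>k. l k \<omega>) (lam / 2) n i h"
  have "emeasure M {\<omega> \<in> space M. ennreal (exp z) \<le> ?Y \<omega>}
     = emeasure M {\<omega> \<in> space M. 1 \<le> ennreal (exp (- z)) * ?Y \<omega>}"
  proof (intro arg_cong[of _ _ "emeasure M"] Collect_cong conj_cong refl)
    fix \<omega>
    show "ennreal (exp z) \<le> ?Y \<omega> \<longleftrightarrow> 1 \<le> ennreal (exp (- z)) * ?Y \<omega>"
    proof
      assume "ennreal (exp z) \<le> ?Y \<omega>"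
      then have "ennreal (exp (- z)) * ennreal (exp z) \<le> ennreal (exp (- z)) * ?Y \<omega>" by (rule mult_left_mono) auto
      then show "1 \<le> ennreal (exp (- z)) * ?Y \<omega>" by (simp add: ennreal_mult[symmetric] mult_exp_exp)
    next
      assume "1 \<le> ennreal (exp (- z)) * ?Y \<omega>"
      then have "ennreal (exp z) * 1 \<le> ennreal (exp z) * (ennreal (exp (- z)) * ?Y \<omega>)" by (rule mult_left_mono) auto
      then show "ennreal (exp z) \<le> ?Y \<omega>"
        by (simp add: ennreal_mult[symmetric] mult.assoc[symmetric] mult_exp_exp)
    qed
  qed
  also have "\<dots> \<le> ennreal (exp (- z)) * (\<integral>\<^sup>+\<omega>. ?Y \<omega> * indicator (space M) \<omega> \<partial>M)"
    using nn_integral_Markov_inequality[of ?Y "space M" M "ennreal (exp (- z))"] by auto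
  also have "(\<integral>\<^sup>+\<omega>. ?Y \<omega> * indicator (space M) \<omega> \<partial>M) = ennreal ((2 * inverse_square_sum) ^ n)"
    using path_sum_expectation[OF assms(1) ind D, of "{}" i n h] inverse_square_sum_ge_1
    by (simp add: ennreal_power cong: nn_integral_cong)
  also have "ennreal (exp (- z)) * \<dots> = ennreal (exp (- z) * (2 * inverse_square_sum) ^ n)"
    using inverse_square_sum_ge_1 by (simp add: ennreal_mult)
  finally show ?thesis
    using inverse_square_sum_ge_1 by (simp add: emeasure_eq_measure)
qed

end

section \<open>Force and entropy in a single column\<close>

lemma int_encode_le: "real (int_encode d) \<le> 2 * \<bar>real_of_int d\<bar>"
  by (auto simp: int_encode_def sum_encode_def)

lemma step_weight_pos: "0 < step_weight L \<theta> i h h' r"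
  by (auto simp: step_weight_def intro!: divide_pos_pos mult_pos_pos zero_less_power add_pos_nonneg)

lemma ln_step_weight:
  "ln (step_weight L \<theta> i h h' r) =
     \<theta> * (\<Sum>j\<in>{h'..<h' + int r}. L (i, j)) - real r * ln 4 - 2 * ln (1 + real (int_encode (h' - h)))"
  by (simp add: step_weight_def ln_div ln_mult ln_realpow add_pos_nonneg)

text \<open>The entropy of a jump is logarithmic in its length. Since
  \<open>X + T \<le> X * (1 + T)\<close>, it splits into a part paid by the potential
  \<open>X\<close> and a part paid by the variation \<open>T\<close>.\<close>

lemma ln_step_weight_ge:
  fixes x X T :: real
  assumes near: "\<bar>x - of_int h'\<bar> \<le> 1" and X: "1 + \<bar>x - of_int h\<bar> \<le> X + T" and "1 \<le> X" "0 \<le> T"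
  shows "\<theta> * (\<Sum>j\<in>{h'..<h' + int r}. L (i, j)) - 2 * real r - 4 - 2 * ln X - 2 * ln (1 + T)
    \<le> ln (step_weight L \<theta> i h h' r)"
proof -
  have l2: "ln (2::real) \<le> 1" using ln_le_minus_one[of 2] by simp
  have "ln (4::real) = 2 * ln 2" using ln_realpow[of 2 2] by simp
  then have r: "real r * ln 4 \<le> real r * 2" using l2 by (intro mult_left_mono) auto
  have "real (int_encode (h' - h)) \<le> 2 * \<bar>real_of_int (h' - h)\<bar>" by (rule int_encode_le)
  also have "\<dots> \<le> 2 * (1 + \<bar>x - of_int h\<bar>)" proof -
    have "real_of_int (h' - h) = (x - of_int h) - (x - of_int h')" by simp
    also have "\<bar>\<dots>\<bar> \<le> \<bar>x - of_int h\<bar> + \<bar>x - of_int h'\<bar>" by (rule abs_triangle_ineq4)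
    finally show ?thesis using near by simp
  qed
  finally have "1 + real (int_encode (h' - h)) \<le> 1 + 2 * (1 + \<bar>x - of_int h\<bar>)" by simp
  also have "\<dots> \<le> 3 * (X + T)" proof -
    have "1 + 2 * y \<le> 3 * (X + T)" if "y \<le> X + T" for y using that assms(3,4) by simp
    then show ?thesis using X .
  qed
  also have "\<dots> \<le> 3 * (X * (1 + T))" using mult_right_mono[of 1 X T] assms(3,4) by (simp add: algebra_simps)
  finally have "ln (1 + real (int_encode (h' - h))) \<le> ln (3 * (X * (1 + T)))"
    using assms(3,4) by (subst ln_le_cancel_iff) (auto intro!: mult_pos_pos)
  also have "\<dots> = ln 3 + ln X + ln (1 + T)" using assms(3,4) by (simp add: ln_mult)
  finally show ?thesis unfolding ln_step_weight using r ln_le_minus_one[of 3]  by simp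
qed

lemma MVT_abs_le:
  fixes u :: "real \<Rightarrow> real"
  assumes "\<And>x. p \<le> x \<Longrightarrow> x \<le> q \<Longrightarrow> (u has_real_derivative f x) (at x)"
    and "\<And>x. p \<le> x \<Longrightarrow> x \<le> q \<Longrightarrow> \<bar>f x\<bar> \<le> B"
    and "x \<in> {p..q}" "y \<in> {p..q}"
  shows "\<bar>u y - u x\<bar> \<le> B * \<bar>y - x\<bar>"
proof -
  have "norm (u y - u x) \<le> B * norm (y - x)"
    by (rule field_differentiable_bound[where S = "{p..q}" and f' = f])
      (use assms in \<open>auto intro: has_field_derivative_at_within\<close>)
  then show ?thesis by simp
qed

text \<open>The function \<open>2 * arctan (u - j - 1/2)\<close> changes at rate at least \<open>\<bar>u'\<bar> \<ge> s\<close> while \<open>u\<close> is in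
  the strip of obstacle \<open>j\<close>, but by less than \<open>2 * pi\<close> in total, so \<open>u\<close> spends time at most
  \<open>2 * pi / s\<close> in that strip.\<close>
lemma fast_crossing:
  fixes u f w Q :: "real \<Rightarrow> real" and A :: "int \<Rightarrow> real"
  assumes "p \<le> q" and "finite J"
    and du: "\<And>x. p \<le> x \<Longrightarrow> x \<le> q \<Longrightarrow> (u has_real_derivative f x) (at x)"
    and dQ: "\<And>x. p \<le> x \<Longrightarrow> x \<le> q \<Longrightarrow> (Q has_real_derivative w x) (at x)"
    and w: "\<And>x. p \<le> x \<Longrightarrow> x \<le> q \<Longrightarrow> 0 \<le> w x \<and> w x \<le> A \<lfloor>u x\<rfloor>"
    and J: "\<And>x. p \<le> x \<Longrightarrow> x \<le> q \<Longrightarrow> \<lfloor>u x\<rfloor> \<in> J"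
    and A: "\<And>j. 0 \<le> A j"
    and "\<sigma> = 1 \<or> \<sigma> = -1"
    and f: "\<And>x. p \<le> x \<Longrightarrow> x \<le> q \<Longrightarrow> s \<le> \<sigma> * f x" and "0 \<le> s"
  shows "s * (Q q - Q p) \<le> 2 * pi * (\<Sum>j\<in>J. A j)"
proof -
  define H where "H x = \<sigma> * (\<Sum>j\<in>J. A j * (2 * arctan (u x - (of_int j + 1/2)))) - s * Q x" for x
  define H' where "H' x = \<sigma> * (\<Sum>j\<in>J. A j * (2 * (f x / (1 + (u x - (of_int j + 1/2))\<^sup>2)))) - s * w x" for x
  have "H p \<le> H q"
  proof (rule DERIV_nonneg_imp_nondecreasing[OF \<open>p \<le> q\<close>])
    fix x assume x: "p \<le> x" "x \<le> q"
    have "(H has_real_derivative H' x) (at x)"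
      unfolding H_def H'_def
      by (rule derivative_eq_intros du dQ x refl sum.cong | simp add: field_simps)+
    moreover have "0 \<le> H' x"
    proof -
      \<comment> \<open>Only the strip \<open>k\<close> containing \<open>u x\<close> exerts force.
        There \<open>u x\<close> is within distance 1 of the centre, so its arctan term has weight
        at least 1; the other terms are nonnegative.\<close>
      define t where "t j = 2 / (1 + (u x - (of_int j + 1/2))\<^sup>2)" for j :: int
      define k where "k = \<lfloor>u x\<rfloor>"
      have t0: "0 \<le> t j" for j by (simp add: t_def add_nonneg_nonneg)
      have "\<bar>u x - (of_int k + 1/2)\<bar> \<le> 1" unfolding k_def by linarith
      then have "(u x - (of_int k + 1/2))\<^sup>2 \<le> 1" by (simp add: abs_square_le_1)
      then have t1: "1 \<le> t k" unfolding t_def by (subst le_divide_eq_1_pos) (auto intro: add_pos_nonneg)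
      have fx: "0 \<le> \<sigma> * f x" using f[OF x] \<open>0 \<le> s\<close> by linarith
      have "s * w x \<le> (\<sigma> * f x) * (A k * 1)"
        using f[OF x] w[OF x] \<open>0 \<le> s\<close> fx by (intro mult_mono) (auto simp: k_def)
      also have "\<dots> \<le> (\<sigma> * f x) * (A k * t k)"
        using t1 A fx by (intro mult_left_mono) auto
      also have "\<dots> \<le> (\<Sum>j\<in>J. (\<sigma> * f x) * (A j * t j))"
        using J[OF x] \<open>finite J\<close> A t0 fx by (intro member_le_sum[of k J "\<lambda>j. (\<sigma> * f x) * (A j * t j)"]) (auto simp: k_def)
      also have "\<dots> = H' x + s * w x"
        by (simp add: H'_def t_def sum_distrib_left ac_simps)
      finally show ?thesis by simp
    qed
    ultimately show "\<exists>y. (H has_real_derivative y) (at x) \<and> 0 \<le> y" by blast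
  qed
  then have "s * (Q q - Q p) \<le> \<sigma> * (\<Sum>j\<in>J. A j * (2 * (arctan (u q - (of_int j + 1/2)) - arctan (u p - (of_int j + 1/2)))))"
    by (simp add: H_def algebra_simps sum_subtractf)
  also have "\<dots> = (\<Sum>j\<in>J. A j * (2 * (\<sigma> * (arctan (u q - (of_int j + 1/2)) - arctan (u p - (of_int j + 1/2))))))"
    by (simp add: sum_distrib_left ac_simps)
  also have "\<dots> \<le> (\<Sum>j\<in>J. A j * (2 * pi))"
  proof (intro sum_mono mult_left_mono A)
    fix j
    show "\<sigma> * (arctan (u q - (of_int j + 1/2)) - arctan (u p - (of_int j + 1/2))) \<le> pi"
      using \<open>\<sigma> = 1 \<or> \<sigma> = -1\<close> arctan_bounded[of "u q - (of_int j + 1/2)"] arctan_bounded[of "u p - (of_int j + 1/2)"]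
      by auto
  qed auto
  finally show ?thesis by (simp add: sum_distrib_left sum_distrib_right ac_simps)
qed

text \<open>The term \<open>2 * ln (2 + \<bar>u - h\<bar> + \<bar>f\<bar>)\<close> is a potential: the distance from the last recorded
  level grows by at most \<open>\<bar>f\<bar> + T\<close> per skipped column, and the potential pays the entropy of the next
  jump.\<close>
lemma cell_step:
  fixes u f w Q W :: "real \<Rightarrow> real" and L :: "int \<times> int \<Rightarrow> real" and h i :: int
  assumes "p \<le> q" "q \<le> p + 1"
    and du: "\<And>x. p \<le> x \<Longrightarrow> x \<le> q \<Longrightarrow> (u has_real_derivative f x) (at x)"
    and dQ: "\<And>x. p \<le> x \<Longrightarrow> x \<le> q \<Longrightarrow> (Q has_real_derivative w x) (at x)"
    and w: "\<And>x. p \<le> x \<Longrightarrow> x \<le> q \<Longrightarrow> 0 \<le> w x \<and> w x \<le> \<Phi> * L (i, \<lfloor>u x\<rfloor>)"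
    and L: "\<And>j. 0 \<le> L (i, j)"
    and dW: "\<And>x y. p \<le> x \<Longrightarrow> x \<le> y \<Longrightarrow> y \<le> q \<Longrightarrow> \<bar>f y - f x\<bar> \<le> W y - W x"
    and "0 < \<Phi>" "0 < \<theta>" and \<kappa>: "\<kappa> = \<theta> / (2 * pi * \<Phi>)"
  shows "\<exists>h' r. \<kappa> / 2 * (Q q - Q p) - 36 - 4 * ln (1 + (W q - W p)) + 2 * ln (2 + \<bar>u q - of_int h'\<bar> + \<bar>f q\<bar>)
    \<le> ln (step_weight L \<theta> i h h' r) + 2 * ln (2 + \<bar>u p - of_int h\<bar> + \<bar>f p\<bar>)"
proof -
  define T where "T = W q - W p"
  define \<sigma> where "\<sigma> = \<bar>f p\<bar>"
  define X where "X = 2 + \<bar>u p - of_int h\<bar> + \<bar>f p\<bar>"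
  define q' where "q' = Q q - Q p"
  have "0 \<le> T" using dW[of p q] \<open>p \<le> q\<close> by (simp add: T_def)
  have X: "2 \<le> X" by (simp add: X_def)
  have "0 < \<kappa>" using \<kappa> \<open>0 < \<Phi>\<close> \<open>0 < \<theta>\<close> by simp
  have df: "\<bar>f x - f p\<bar> \<le> T" if "p \<le> x" "x \<le> q" for x
    using dW[of p x] dW[of x q] that by (simp add: T_def)
  have fb: "\<bar>f x\<bar> \<le> \<sigma> + T" if "p \<le> x" "x \<le> q" for x
    using df[OF that] by (simp add: \<sigma>_def)
  have var: "\<bar>u y - u x\<bar> \<le> \<sigma> + T" if "x \<in> {p..q}" "y \<in> {p..q}" for x y
  proof -
    have "\<bar>u y - u x\<bar> \<le> (\<sigma> + T) * \<bar>y - x\<bar>" by (rule MVT_abs_le[OF du fb that])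
    also have "\<dots> \<le> (\<sigma> + T) * 1"
      using that \<open>q \<le> p + 1\<close> \<open>0 \<le> T\<close> by (intro mult_left_mono) (auto simp: \<sigma>_def)
    finally show ?thesis by simp
  qed
  have q'0: "0 \<le> q'"
  proof -
    have "Q p \<le> Q q" by (rule DERIV_nonneg_imp_nondecreasing[OF \<open>p \<le> q\<close>]) (use dQ w in blast)
    then show ?thesis by (simp add: q'_def)
  qed
  \<comment> \<open>As the column has width at most 1, the force at some point is at least the total
    force \<open>q'\<close> of the column; the obstacle met there is the one recorded in the slow
    case.\<close>
  have mvt: "\<exists>z\<in>{p..q}. q' \<le> w z"
  proof (cases "p = q")
    case True
    then show ?thesis using w[of p] by (auto simp: q'_def)
  next
    case False
    then have "p < q" using \<open>p \<le> q\<close> by simp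
    then obtain z where z: "p < z" "z < q" "Q q - Q p = (q - p) * w z"
      using MVT2[of p q Q w] dQ by auto
    have "(q - p) * w z \<le> 1 * w z" using w[of z] z \<open>q \<le> p + 1\<close> by (intro mult_right_mono) auto
    then show ?thesis using z by (intro bexI[of _ z]) (auto simp: q'_def)
  qed
  have XT: "X + T \<le> X * (1 + T)" using mult_right_mono[of 1 X T] X \<open>0 \<le> T\<close> by (simp add: algebra_simps)
  have goal: "?thesis" if "\<kappa> / 2 * q' - 36 - 4 * ln (1 + T) + 2 * ln (2 + \<bar>u q - of_int h'\<bar> + \<bar>f q\<bar>)
      \<le> ln (step_weight L \<theta> i h h' r) + 2 * ln X" for h' r
    using that unfolding q'_def T_def X_def by blast
  \<comment> \<open>Slow: one obstacle is recorded. Skip: nothing is recorded, and the constant 36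
    covers the force term, at most 34, plus \<open>2 * ln 2\<close>, at most 2. Fast: a whole window
    of obstacles is recorded.\<close>
  consider (slow) "\<sigma> \<le> 2 + 2 * T" | (skip) "q' \<le> 68 / \<kappa>" | (fast) "2 + 2 * T < \<sigma>" "68 / \<kappa> < q'" by linarith
  then show ?thesis
  proof cases
    case slow
    obtain z where z: "z \<in> {p..q}" "q' \<le> w z" using mvt by blast
    define h' where "h' = \<lfloor>u z\<rfloor>"
    have near: "\<bar>u z - of_int h'\<bar> \<le> 1" unfolding h'_def by linarith
    have "\<bar>u z - of_int h\<bar> \<le> \<bar>u p - of_int h\<bar> + (\<sigma> + T)"
      using var[of p z] z \<open>p \<le> q\<close> by auto
    then have "1 + \<bar>u z - of_int h\<bar> \<le> X + T" by (simp add: X_def \<sigma>_def)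
    then have sw: "\<theta> * (\<Sum>j\<in>{h'..<h' + int 1}. L (i, j)) - 2 * real 1 - 4 - 2 * ln X - 2 * ln (1 + T)
        \<le> ln (step_weight L \<theta> i h h' 1)"
      by (rule ln_step_weight_ge[OF near]) (use X \<open>0 \<le> T\<close> in auto)
    have "{h'..<h' + int 1} = {h'}" by auto
    then have "(\<Sum>j\<in>{h'..<h' + int 1}. L (i, j)) = L (i, h')" by simp
    moreover have "\<kappa> / 2 * q' \<le> \<theta> * L (i, h')"
    proof -
      have "q' \<le> \<Phi> * L (i, h')" using z w[of z] by (auto simp: h'_def)
      then have "\<kappa> / 2 * q' \<le> \<kappa> / 2 * (\<Phi> * L (i, h'))" using \<open>0 < \<kappa>\<close> by (intro mult_left_mono) auto
      also have "\<dots> = \<theta> * L (i, h') / (4 * pi)" using \<open>0 < \<Phi>\<close> by (simp add: \<kappa> field_simps)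
      also have "\<dots> \<le> \<theta> * L (i, h') / 1"
        using L[of h'] \<open>0 < \<theta>\<close> pi_gt3 by (intro divide_left_mono) auto
      finally show ?thesis by simp
    qed
    moreover have "ln (2 + \<bar>u q - of_int h'\<bar> + \<bar>f q\<bar>) \<le> 6 + ln (1 + T)"
    proof -
      have "\<bar>u q - of_int h'\<bar> \<le> 1 + (\<sigma> + T)"
        using var[of z q] z \<open>p \<le> q\<close> near by auto
      then have "2 + \<bar>u q - of_int h'\<bar> + \<bar>f q\<bar> \<le> 7 * (1 + T)"
        using fb[of q] \<open>p \<le> q\<close> slow \<open>0 \<le> T\<close> by simp
      then have "ln (2 + \<bar>u q - of_int h'\<bar> + \<bar>f q\<bar>) \<le> ln (7 * (1 + T))"
        by (intro ln_mono) auto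
      also have "\<dots> = ln 7 + ln (1 + T)" using \<open>0 \<le> T\<close> by (intro ln_mult_pos) auto
      also have "\<dots> \<le> 6 + ln (1 + T)" using ln_le_minus_one[of 7] by simp
      finally show ?thesis .
    qed
    ultimately show ?thesis
      using sw by (intro goal[of h' 1]) simp
  next
    case skip
    have "\<bar>u q - of_int h\<bar> \<le> \<bar>u p - of_int h\<bar> + (\<sigma> + T)"
      using var[of p q] \<open>p \<le> q\<close> by auto
    moreover have "2 + a + b \<le> 2 * ((2 + d + \<sigma>) + T)"
      if "a \<le> d + (\<sigma> + T)" "b \<le> \<sigma> + T" "0 \<le> d" for a b d :: real using that by simp
    moreover have "\<bar>f q\<bar> \<le> \<sigma> + T" using fb[of q] \<open>p \<le> q\<close> by simp
    ultimately have "2 + \<bar>u q - of_int h\<bar> + \<bar>f q\<bar> \<le> 2 * (X + T)"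
      unfolding X_def \<sigma>_def[symmetric] by (meson abs_ge_zero)
    also have "\<dots> \<le> 2 * (X * (1 + T))" using XT by simp
    finally have "ln (2 + \<bar>u q - of_int h\<bar> + \<bar>f q\<bar>) \<le> ln (2 * (X * (1 + T)))"
      by (intro ln_mono) auto
    also have "\<dots> = ln 2 + (ln X + ln (1 + T))"
      using X \<open>0 \<le> T\<close> by (subst ln_mult_pos, simp, simp, subst ln_mult_pos) auto
    also have "\<dots> \<le> 1 + ln X + ln (1 + T)" using ln_le_minus_one[of 2] by simp
    finally have "ln (2 + \<bar>u q - of_int h\<bar> + \<bar>f q\<bar>) \<le> 1 + ln X + ln (1 + T)" .
    moreover have "ln (step_weight L \<theta> i h h 0) = 0"
      by (simp add: ln_step_weight int_encode_def sum_encode_def)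
    moreover have "\<kappa> / 2 * q' \<le> 34" using skip \<open>0 < \<kappa>\<close> by (simp add: field_simps)
    moreover have "0 \<le> ln (1 + T)" using \<open>0 \<le> T\<close> by simp
    ultimately show ?thesis by (intro goal[of h 0]) simp
  next
    case fast
    \<comment> \<open>The path stays within \<open>\<sigma> + T\<close> of \<open>u p\<close>, so
      the recorded levels run over this window; \<open>2 + 2 * T < \<sigma>\<close> keeps their
      number below \<open>3 * \<sigma>\<close>.\<close>
    define a where "a = u p - (\<sigma> + T)"
    define h' where "h' = \<lfloor>a\<rfloor>"
    define r where "r = nat (\<lfloor>u p + (\<sigma> + T)\<rfloor> - h' + 1)"
    have "h' \<le> \<lfloor>u p + (\<sigma> + T)\<rfloor>" unfolding h'_def a_def using \<open>0 \<le> T\<close> fast by (intro floor_mono) auto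
    then have r: "int r = \<lfloor>u p + (\<sigma> + T)\<rfloor> - h' + 1" by (simp add: r_def)
    have near: "\<bar>a - of_int h'\<bar> \<le> 1" unfolding h'_def by linarith
    have "real r = of_int (\<lfloor>u p + (\<sigma> + T)\<rfloor> - h' + 1)" using r by (metis of_int_of_nat_eq)
    also have "\<dots> \<le> u p + (\<sigma> + T) - a + 2"
      using of_int_floor_le[of "u p + (\<sigma> + T)"] floor_correct[of a]
      unfolding h'_def[symmetric] of_int_add of_int_diff of_int_1 by linarith
    also have "\<dots> \<le> 3 * \<sigma>" using fast by (simp add: a_def)
    finally have r_le: "real r \<le> 3 * \<sigma>" .
    have "1 + \<bar>a - of_int h\<bar> \<le> X + T" using \<open>0 \<le> T\<close> fast by (simp add: X_def a_def \<sigma>_def)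
    then have sw: "\<theta> * (\<Sum>j\<in>{h'..<h' + int r}. L (i, j)) - 2 * real r - 4 - 2 * ln X - 2 * ln (1 + T)
        \<le> ln (step_weight L \<theta> i h h' r)"
      by (rule ln_step_weight_ge[OF near]) (use X \<open>0 \<le> T\<close> in auto)
    define s where "s = (if 0 \<le> f p then 1 else - 1 :: real)"
    \<comment> \<open>Here \<open>T < \<sigma> / 2\<close>, so the slope keeps its sign and has size
      at least \<open>\<sigma> / 2\<close>. The value of \<open>\<kappa>\<close> turns the resulting
      bound into exactly \<open>\<theta>\<close> times the recorded sum.\<close>
    have "\<sigma> / 2 * (Q q - Q p) \<le> 2 * pi * (\<Sum>j\<in>{h'..<h' + int r}. \<Phi> * L (i, j))"
    proof (rule fast_crossing[OF \<open>p \<le> q\<close> _ du dQ, where \<sigma> = s])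
      show "\<lfloor>u x\<rfloor> \<in> {h'..<h' + int r}" if "p \<le> x" "x \<le> q" for x
      proof -
        have "a \<le> u x" "u x \<le> u p + (\<sigma> + T)" using var[of p x] that \<open>p \<le> q\<close> by (auto simp: a_def)
        then have "h' \<le> \<lfloor>u x\<rfloor>" "\<lfloor>u x\<rfloor> \<le> \<lfloor>u p + (\<sigma> + T)\<rfloor>" unfolding h'_def by (auto intro: floor_mono)
        then show ?thesis using r by simp
      qed
      show "\<sigma> / 2 \<le> s * f x" if "p \<le> x" "x \<le> q" for x
        using df[OF that] fast by (auto simp: s_def \<sigma>_def)
      show "0 \<le> w x \<and> w x \<le> \<Phi> * L (i, \<lfloor>u x\<rfloor>)" if "p \<le> x" "x \<le> q" for x using w[OF that] .
      show "0 \<le> \<Phi> * L (i, j)" for j using L[of j] \<open>0 < \<Phi>\<close> by simp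
      show "s = 1 \<or> s = - 1" by (simp add: s_def)
      show "0 \<le> \<sigma> / 2" by (simp add: \<sigma>_def)
    qed auto
    then have "\<sigma> / 2 * q' \<le> 2 * pi * \<Phi> * (\<Sum>j\<in>{h'..<h' + int r}. L (i, j))"
      by (simp add: q'_def sum_distrib_left[symmetric] ac_simps)
    then have "\<kappa> * (\<sigma> / 2 * q') \<le> \<kappa> * (2 * pi * \<Phi> * (\<Sum>j\<in>{h'..<h' + int r}. L (i, j)))"
      using \<open>0 < \<kappa>\<close> by (intro mult_left_mono) auto
    also have "\<dots> = \<theta> * (\<Sum>j\<in>{h'..<h' + int r}. L (i, j))" using \<open>0 < \<Phi>\<close> by (simp add: \<kappa>)
    finally have energy: "\<kappa> * (\<sigma> / 2 * q') \<le> \<theta> * (\<Sum>j\<in>{h'..<h' + int r}. L (i, j))" .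
    have "2 \<le> \<sigma>" using fast \<open>0 \<le> T\<close> by simp
    \<comment> \<open>The energy \<open>\<kappa> * q' * \<sigma> / 2\<close> is halved. One half
      covers \<open>17 * \<sigma>\<close>, enough for \<open>6 * \<sigma>\<close> from the record
      length and \<open>10 * \<sigma>\<close> from the new potential; the other covers
      \<open>\<kappa> / 2 * q'\<close>.\<close>
    have "34 * 2 \<le> \<kappa> * q'" using fast \<open>0 < \<kappa>\<close> by (simp add: field_simps)
    then have k1: "34 * 2 * (\<sigma> / 4) \<le> \<kappa> * q' * (\<sigma> / 4)" using \<open>2 \<le> \<sigma>\<close> by (intro mult_right_mono) auto
    have k2: "\<kappa> * q' * 2 / 4 \<le> \<kappa> * q' * \<sigma> / 4"
      using \<open>2 \<le> \<sigma>\<close> \<open>0 < \<kappa>\<close> q'0 by (intro divide_right_mono mult_left_mono) auto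
    have "\<bar>u q - of_int h'\<bar> \<le> 1 + 2 * (\<sigma> + T)"
    proof -
      have "u q - of_int h' = (u q - u p) + (\<sigma> + T) + (a - of_int h')" by (simp add: a_def)
      also have "\<bar>\<dots>\<bar> \<le> \<bar>u q - u p\<bar> + \<bar>\<sigma> + T\<bar> + \<bar>a - of_int h'\<bar>" by linarith
      finally show ?thesis using var[of p q] \<open>p \<le> q\<close> near \<open>0 \<le> T\<close> \<open>2 \<le> \<sigma>\<close> by simp
    qed
    then have "2 + \<bar>u q - of_int h'\<bar> + \<bar>f q\<bar> \<le> 5 * \<sigma>"
      using fb[of q] \<open>p \<le> q\<close> fast \<open>0 \<le> T\<close> by simp
    then have "ln (2 + \<bar>u q - of_int h'\<bar> + \<bar>f q\<bar>) \<le> 5 * \<sigma>"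
      by (intro order.trans[OF ln_bound]) (auto intro: add_pos_nonneg)
    moreover have "0 \<le> ln (1 + T)" using \<open>0 \<le> T\<close> by simp
    moreover have "\<kappa> / 2 * q' + 17 * \<sigma> \<le> \<kappa> * (\<sigma> / 2 * q')" using k1 k2 by (simp add: ac_simps)
    ultimately show ?thesis
      using sw energy r_le \<open>2 \<le> \<sigma>\<close> by (intro goal[of h' r]) linarith
  qed
qed

section \<open>Summation over the columns\<close>

text \<open>Backward induction over the columns: the potential left by one column pays for entering
  the next, so only the initial one survives; the final one is nonnegative and is dropped.\<close>

lemma path_sum_lower_bound_partition:
  fixes u f w Q W :: "real \<Rightarrow> real" and L :: "int \<times> int \<Rightarrow> real" and P :: "nat \<Rightarrow> real"
  assumes P: "\<And>k. k < n \<Longrightarrow> P k \<le> P (Suc k) \<and> P (Suc k) \<le> P k + 1"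
    and du: "\<And>k x. k < n \<Longrightarrow> P k \<le> x \<Longrightarrow> x \<le> P (Suc k) \<Longrightarrow> (u has_real_derivative f x) (at x)"
    and dQ: "\<And>k x. k < n \<Longrightarrow> P k \<le> x \<Longrightarrow> x \<le> P (Suc k) \<Longrightarrow> (Q has_real_derivative w x) (at x)"
    and w: "\<And>k x. k < n \<Longrightarrow> P k < P (Suc k) \<Longrightarrow> P k \<le> x \<Longrightarrow> x \<le> P (Suc k) \<Longrightarrow>
              0 \<le> w x \<and> w x \<le> \<Phi> * L (i + int k, \<lfloor>u x\<rfloor>)"
    and L: "\<And>k. 0 \<le> L k"
    and dW: "\<And>k x y. k < n \<Longrightarrow> P k \<le> x \<Longrightarrow> x \<le> y \<Longrightarrow> y \<le> P (Suc k) \<Longrightarrow> \<bar>f y - f x\<bar> \<le> W y - W x"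
    and "0 < \<Phi>" "0 < \<theta>" and \<kappa>: "\<kappa> = \<theta> / (2 * pi * \<Phi>)"
    and "k \<le> n"
  shows "ennreal (exp ((\<Sum>m\<in>{k..<n}. \<kappa> / 2 * (Q (P (Suc m)) - Q (P m)) - 36
              - 4 * ln (1 + (W (P (Suc m)) - W (P m))))
            - 2 * ln (2 + \<bar>u (P k) - of_int h\<bar> + \<bar>f (P k)\<bar>)))
    \<le> path_sum L \<theta> (n - k) (i + int k) h"
  using \<open>k \<le> n\<close>
proof (induction k arbitrary: h rule: inc_induct)
  case base
  have "0 \<le> ln (2 + \<bar>u (P n) - of_int h\<bar> + \<bar>f (P n)\<bar>)" by (intro ln_ge_zero) auto
  then have "exp (- 2 * ln (2 + \<bar>u (P n) - of_int h\<bar> + \<bar>f (P n)\<bar>)) \<le> 1" by simp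
  then show ?case by simp
next
  case (step k)
  define c where "c m = \<kappa> / 2 * (Q (P (Suc m)) - Q (P m)) - 36 - 4 * ln (1 + (W (P (Suc m)) - W (P m)))" for m
  define X where "X m h = 2 * ln (2 + \<bar>u (P m) - of_int h\<bar> + \<bar>f (P m)\<bar>)" for m and h :: int
  have "\<exists>h' r. c k + X (Suc k) h' \<le> ln (step_weight L \<theta> (i + int k) h h' r) + X k h"
  \<comment> \<open>A column that misses the interval is a degenerate cell; staying at
    \<open>h\<close> with no record has weight 1.\<close>
  proof (cases "P k = P (Suc k)")
    case True
    then have "c k + X (Suc k) h \<le> ln (step_weight L \<theta> (i + int k) h h 0) + X k h"
      by (simp add: c_def X_def ln_step_weight int_encode_def sum_encode_def)
    then show ?thesis by blast
  next
    case False
    then show ?thesis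
      unfolding c_def X_def
      using cell_step[of "P k" "P (Suc k)" u f Q w \<Phi> L "i + int k" W \<theta> \<kappa> h]
        P[OF step.hyps(2)] du[OF step.hyps(2)] dQ[OF step.hyps(2)] w[OF step.hyps(2)] dW[OF step.hyps(2)] L \<open>0 < \<Phi>\<close> \<open>0 < \<theta>\<close> \<kappa>
      by simp
  qed
  then obtain h' r where hr: "c k + X (Suc k) h' \<le> ln (step_weight L \<theta> (i + int k) h h' r) + X k h" by blast
  have "exp ((\<Sum>m\<in>{k..<n}. c m) - X k h)
     = exp ((c k + X (Suc k) h' - X k h) + ((\<Sum>m\<in>{Suc k..<n}. c m) - X (Suc k) h'))"
    using step.hyps by (simp add: sum.atLeast_Suc_lessThan)
  also have "\<dots> \<le> exp (ln (step_weight L \<theta> (i + int k) h h' r) + ((\<Sum>m\<in>{Suc k..<n}. c m) - X (Suc k) h'))"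
    using hr by simp
  also have "\<dots> = step_weight L \<theta> (i + int k) h h' r * exp ((\<Sum>m\<in>{Suc k..<n}. c m) - X (Suc k) h')"
    using step_weight_pos by (simp add: exp_add)
  finally have "ennreal (exp ((\<Sum>m\<in>{k..<n}. c m) - X k h))
    \<le> ennreal (step_weight L \<theta> (i + int k) h h' r * exp ((\<Sum>m\<in>{Suc k..<n}. c m) - X (Suc k) h'))"
    by (rule ennreal_leI)
  also have "\<dots> = ennreal (step_weight L \<theta> (i + int k) h h' r) * ennreal (exp ((\<Sum>m\<in>{Suc k..<n}. c m) - X (Suc k) h'))"
    by (rule ennreal_mult) (auto intro: step_weight_nonneg)
  also have "\<dots> \<le> ennreal (step_weight L \<theta> (i + int k) h h' r) * path_sum L \<theta> (n - Suc k) (i + int k + 1) h'"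
    using step.IH[of h'] by (intro mult_left_mono) (simp_all add: c_def X_def ac_simps)
  also have "\<dots> \<le> path_sum L \<theta> (Suc (n - Suc k)) (i + int k) h"
    by (rule path_sum_step)
  also have "Suc (n - Suc k) = n - k" using step.hyps by simp
  finally show ?case by (simp add: c_def X_def)
qed

text \<open>From \<open>ln y \<le> y - 1\<close> at \<open>y = (1 + t) * e\<close>. A small
  \<open>e\<close> lets the logarithms of the variations be absorbed by the total variation, at a
  constant cost per column.\<close>

lemma ln_one_plus_le_scaled:
  fixes t e :: real
  assumes "0 \<le> t" "0 < e" "e \<le> 1"
  shows "ln (1 + t) \<le> e * t - ln e"
proof -
  have "ln (1 + t) + ln e = ln ((1 + t) * e)" using assms by (simp add: ln_mult_pos)
  also have "\<dots> \<le> (1 + t) * e - 1" using assms by (intro ln_le_minus_one) auto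
  also have "\<dots> \<le> e * t" using assms by (simp add: algebra_simps)
  finally show ?thesis by simp
qed

text \<open>The right-hand side does not depend on \<open>a\<close> and \<open>b\<close>: the path
  always starts in column \<open>i\<close> at level 0, and the initial potential pays for reaching
  \<open>u a\<close>. Hence no union bound over the subinterval is needed.\<close>

lemma path_sum_lower_bound:
  fixes u f w Q W :: "real \<Rightarrow> real" and L :: "int \<times> int \<Rightarrow> real"
  assumes ab: "\<alpha> \<le> a" "a \<le> b" "b \<le> \<alpha> + real n"
    and du: "\<And>x. a \<le> x \<Longrightarrow> x \<le> b \<Longrightarrow> (u has_real_derivative f x) (at x)"
    and dQ: "\<And>x. a \<le> x \<Longrightarrow> x \<le> b \<Longrightarrow> (Q has_real_derivative w x) (at x)"
    and w: "\<And>k x. k < n \<Longrightarrow> a \<le> x \<Longrightarrow> x \<le> b \<Longrightarrow> \<alpha> + real k \<le> x \<Longrightarrow> x \<le> \<alpha> + real k + 1 \<Longrightarrow>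
              0 \<le> w x \<and> w x \<le> \<Phi> * L (i + int k, \<lfloor>u x\<rfloor>)"
    and L: "\<And>k. 0 \<le> L k"
    and dW: "\<And>x y. a \<le> x \<Longrightarrow> x \<le> y \<Longrightarrow> y \<le> b \<Longrightarrow> \<bar>f y - f x\<bar> \<le> W y - W x"
    and "0 < \<Phi>" "0 < \<theta>" and \<kappa>: "\<kappa> = \<theta> / (2 * pi * \<Phi>)"
    and e: "0 < e" "e \<le> 1"
  shows "ennreal (exp (\<kappa> / 2 * (Q b - Q a) - (36 - 4 * ln e) * real n - 4 * e * (W b - W a)
            - 2 * ln (2 + \<bar>u a\<bar> + \<bar>f a\<bar>)))
    \<le> path_sum L \<theta> n i 0"
proof -
  \<comment> \<open>Column boundaries clipped to \<open>[a, b]\<close>; columns outside collapse to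
    a point.\<close>
  define P where "P k = max a (min b (\<alpha> + real k))" for k
  have Pab: "a \<le> P k" "P k \<le> b" for k using ab by (auto simp: P_def)
  have Pmono: "P k \<le> P (Suc k)" for k unfolding P_def by (intro max.mono min.mono) auto
  have Pn: "P 0 = a" "P n = b" using ab by (auto simp: P_def)
  have in_cell: "\<alpha> + real k \<le> x \<and> x \<le> \<alpha> + real k + 1" if "P k < P (Suc k)" "P k \<le> x" "x \<le> P (Suc k)" for k x
    using that ab by (auto simp: P_def max_def min_def split: if_splits)
  have "ennreal (exp ((\<Sum>m\<in>{0..<n}. \<kappa> / 2 * (Q (P (Suc m)) - Q (P m)) - 36
              - 4 * ln (1 + (W (P (Suc m)) - W (P m))))
            - 2 * ln (2 + \<bar>u (P 0) - of_int 0\<bar> + \<bar>f (P 0)\<bar>)))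
    \<le> path_sum L \<theta> (n - 0) (i + int 0) 0"
  proof (rule path_sum_lower_bound_partition[where w = w and W = W and \<Phi> = \<Phi> and P = P])
    show "P k \<le> P (Suc k) \<and> P (Suc k) \<le> P k + 1" for k
      using Pmono by (auto simp: P_def)
    show "(u has_real_derivative f x) (at x)" "(Q has_real_derivative w x) (at x)"
      if "P k \<le> x" "x \<le> P (Suc k)" for k x
      using that Pab(1)[of k] Pab(2)[of "Suc k"] by (auto intro!: du dQ)
    show "0 \<le> w x \<and> w x \<le> \<Phi> * L (i + int k, \<lfloor>u x\<rfloor>)"
      if "k < n" "P k < P (Suc k)" "P k \<le> x" "x \<le> P (Suc k)" for k x
      using that in_cell[OF that(2-4)] Pab(1)[of k] Pab(2)[of "Suc k"] by (intro w) auto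
    show "\<bar>f y - f x\<bar> \<le> W y - W x" if "P k \<le> x" "x \<le> y" "y \<le> P (Suc k)" for k x y
      using that Pab(1)[of k] Pab(2)[of "Suc k"] by (intro dW) auto
  qed (use L \<open>0 < \<Phi>\<close> \<open>0 < \<theta>\<close> \<kappa> in auto)
  then have main: "ennreal (exp ((\<Sum>m\<in>{0..<n}. \<kappa> / 2 * (Q (P (Suc m)) - Q (P m)) - 36
              - 4 * ln (1 + (W (P (Suc m)) - W (P m)))) - 2 * ln (2 + \<bar>u a\<bar> + \<bar>f a\<bar>)))
    \<le> path_sum L \<theta> n i 0"
    by (simp only: Pn of_int_0 diff_zero of_nat_0 add_0_right)
  have "\<kappa> / 2 * (Q b - Q a) - (36 - 4 * ln e) * real n - 4 * e * (W b - W a)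
     \<le> (\<Sum>m\<in>{0..<n}. \<kappa> / 2 * (Q (P (Suc m)) - Q (P m)) - 36 - 4 * ln (1 + (W (P (Suc m)) - W (P m))))"
  proof -
    have tele: "(\<Sum>m\<in>{0..<n}. g (P (Suc m)) - g (P m)) = g b - g a" for g :: "real \<Rightarrow> real"
      using sum_Suc_diff'[of 0 n "\<lambda>m. g (P m)"] by (simp add: Pn)
    have "\<kappa> / 2 * (Q b - Q a) - (36 - 4 * ln e) * real n - 4 * e * (W b - W a)
      = (\<Sum>m\<in>{0..<n}. \<kappa> / 2 * (Q (P (Suc m)) - Q (P m)) - 36 - 4 * (e * (W (P (Suc m)) - W (P m)) - ln e))"
    proof -
      have "(\<Sum>m\<in>{0..<n}. c * p m - 36 - 4 * (e * q m - d)) =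
          c * (\<Sum>m\<in>{0..<n}. p m) - (36 - 4 * d) * real n - 4 * e * (\<Sum>m\<in>{0..<n}. q m)"
        for p q :: "nat \<Rightarrow> real" and c d
        by (simp add: sum_subtractf sum.distrib sum_distrib_left algebra_simps)
      from this[of "\<kappa> / 2" "\<lambda>m. Q (P (Suc m)) - Q (P m)" "\<lambda>m. W (P (Suc m)) - W (P m)" "ln e"]
      show ?thesis unfolding tele by (rule sym)
    qed
    also have "\<dots> \<le> (\<Sum>m\<in>{0..<n}. \<kappa> / 2 * (Q (P (Suc m)) - Q (P m)) - 36 - 4 * ln (1 + (W (P (Suc m)) - W (P m))))"
    proof (intro sum_mono diff_left_mono mult_left_mono)
      fix m
      have "0 \<le> W (P (Suc m)) - W (P m)"
        using dW[of "P m" "P (Suc m)"] Pab Pmono by (meson abs_ge_zero order.trans)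
      then show "ln (1 + (W (P (Suc m)) - W (P m))) \<le> e * (W (P (Suc m)) - W (P m)) - ln e"
        using e by (intro ln_one_plus_le_scaled)
    qed auto
    finally show ?thesis .
  qed
  then show ?thesis
    by (intro order.trans[OF ennreal_leI main]) simp
qed

section \<open>Lower bound on the obstacle force\<close>

text \<open>Take the first point of slope at most \<open>M\<close>. It exists because the mean slope
  up to \<open>x0\<close> is at most 1, and before it \<open>u\<close> climbs at rate more than
  \<open>M\<close>.\<close>

lemma exists_gentle_slope:
  fixes u f :: "real \<Rightarrow> real"
  assumes "\<alpha> < x0"
    and du: "\<And>x. \<alpha> \<le> x \<Longrightarrow> x \<le> x0 \<Longrightarrow> (u has_real_derivative f x) (at x)"
    and cf: "continuous_on {\<alpha>..x0} f"
    and "0 \<le> u \<alpha>" "u x0 < x0 - \<alpha>" "1 \<le> M"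
  shows "\<exists>a. \<alpha> \<le> a \<and> a < x0 \<and> f a \<le> M \<and> M * (a - \<alpha>) \<le> u a"
proof -
  define S where "S = {x\<in>{\<alpha>..x0}. f x \<le> M}"
  obtain z where z: "\<alpha> < z" "z < x0" "u x0 - u \<alpha> = (x0 - \<alpha>) * f z"
    using MVT2[OF \<open>\<alpha> < x0\<close>, of u f] du by auto
  then have "(x0 - \<alpha>) * f z \<le> (x0 - \<alpha>) * 1" unfolding z(3)[symmetric] using assms(4,5) by simp
  then have "f z \<le> 1" using \<open>\<alpha> < x0\<close> by simp
  then have zS: "z \<in> S" using z \<open>1 \<le> M\<close> by (simp add: S_def)
  have "closed S" unfolding S_def by (intro continuous_on_closed_Collect_le cf) auto
  moreover have "bounded S" by (rule bounded_subset[of "{\<alpha>..x0}"]) (auto simp: S_def)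
  ultimately obtain a where a: "a \<in> S" "\<And>t. t \<in> S \<Longrightarrow> a \<le> t"
    using compact_attains_inf[of S] zS by (auto simp: compact_eq_bounded_closed)
  have "M * (a - \<alpha>) \<le> u a"
  proof (cases "\<alpha> = a")
    case False
    then have "\<alpha> < a" using a by (simp add: S_def)
    then obtain y where y: "\<alpha> < y" "y < a" "u a - u \<alpha> = (a - \<alpha>) * f y"
      using MVT2[of \<alpha> a u f] du a by (auto simp: S_def)
    have "M \<le> f y" using a(2)[of y] y a(1) by (fastforce simp: S_def)
    then have "M * (a - \<alpha>) \<le> f y * (a - \<alpha>)" using \<open>\<alpha> < a\<close> by (intro mult_right_mono) auto
    then show ?thesis using y(3) \<open>0 \<le> u \<alpha>\<close> unfolding mult.commute[of "a - \<alpha>"] by linarith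
  qed (use assms in auto)
  then show ?thesis using a(1) a(2)[OF zS] z by (auto simp: S_def)
qed

text \<open>Testing the equation against the hat function with peak \<open>x0\<close> forces a large total obstacle
  force. Shrinking \<open>[\<alpha>, \<beta>]\<close> to \<open>[a, b]\<close> keeps \<open>f a - f b\<close> below \<open>2 * M\<close>, which
  bounds the variation of \<open>f\<close> by the obstacle force.\<close>
lemma obstacle_force_lower_bound:
  fixes u f w Q \<gamma> :: "real \<Rightarrow> real"
  assumes x0: "\<alpha> < x0" "x0 < \<beta>"
    and du: "\<And>x. \<alpha> \<le> x \<Longrightarrow> x \<le> \<beta> \<Longrightarrow> (u has_real_derivative f x) (at x)"
    and df: "\<And>x. \<alpha> \<le> x \<Longrightarrow> x \<le> \<beta> \<Longrightarrow> (f has_real_derivative w x - \<gamma> x) (at x)"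
    and dQ: "\<And>x. \<alpha> \<le> x \<Longrightarrow> x \<le> \<beta> \<Longrightarrow> (Q has_real_derivative w x) (at x)"
    and w: "\<And>x. \<alpha> \<le> x \<Longrightarrow> x \<le> \<beta> \<Longrightarrow> 0 \<le> w x"
    and \<gamma>: "\<And>x. \<alpha> \<le> x \<Longrightarrow> x \<le> \<beta> \<Longrightarrow> F \<le> \<gamma> x"
    and u: "0 \<le> u \<alpha>" "0 \<le> u \<beta>" "u x0 < x0 - \<alpha>" "u x0 < \<beta> - x0"
    and "0 < F" "1 \<le> M"
  shows "\<exists>a b. \<alpha> \<le> a \<and> a \<le> b \<and> b \<le> \<beta> \<and> min (M - 3) (F * (\<beta> - \<alpha>) / 4 - 2) \<le> Q b - Q a
    \<and> - (1 + (Q b - Q a)) \<le> f a \<and> f a \<le> M \<and> - M \<le> f b \<and> u a \<le> (\<beta> - \<alpha>) * (2 + (Q b - Q a))"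
proof -
  have "continuous_on {\<alpha>..\<beta>} f" using df by (intro DERIV_continuous_on[where D = "\<lambda>x. w x - \<gamma> x"]) (auto intro: has_field_derivative_at_within)
  then have cf: "continuous_on S f" if "S \<subseteq> {\<alpha>..\<beta>}" for S using that continuous_on_subset by blast
  obtain a where a: "\<alpha> \<le> a" "a < x0" "f a \<le> M" "M * (a - \<alpha>) \<le> u a"
    using exists_gentle_slope[of \<alpha> x0 u f M] x0 du cf[of "{\<alpha>..x0}"] u \<open>1 \<le> M\<close> by auto
  \<comment> \<open>The right endpoint comes from the same lemma after reflection.\<close>
  have "\<exists>b. - \<beta> \<le> b \<and> b < - x0 \<and> - f (- b) \<le> M \<and> M * (b - - \<beta>) \<le> u (- b)"
  proof (rule exists_gentle_slope)
    show "((\<lambda>x. u (- x)) has_real_derivative - f (- x)) (at x)" if "- \<beta> \<le> x" "x \<le> - x0" for x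
      unfolding DERIV_mirror[symmetric] using du[of "- x"] that x0 by simp
    show "continuous_on {- \<beta>..- x0} (\<lambda>x. - f (- x))"
      by (intro continuous_intros continuous_on_compose2[OF cf[of "{\<alpha>..\<beta>}"]]) (use x0 in auto)
  qed (use x0 u \<open>1 \<le> M\<close> in auto)
  then obtain b' where "- \<beta> \<le> b'" "b' < - x0" "- f (- b') \<le> M" "M * (b' - - \<beta>) \<le> u (- b')" by blast
  then obtain b where b: "b \<le> \<beta>" "x0 < b" "- M \<le> f b" "M * (\<beta> - b) \<le> u b"
    by (intro that[of "- b'"]) (auto simp: algebra_simps)
  define B1 B2 where "B1 = Q x0 - Q a" and "B2 = Q b - Q x0"
  have B: "Q b - Q a = B1 + B2" by (simp add: B1_def B2_def)
  have Qmono: "Q x \<le> Q y" if "a \<le> x" "x \<le> y" "y \<le> b" for x y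
    by (rule DERIV_nonneg_imp_nondecreasing[OF \<open>x \<le> y\<close>])
      (use dQ w that a b in \<open>meson order.trans\<close>)
  have drop: "f y - f x \<le> Q y - Q x - F * (y - x)" if "a \<le> x" "x \<le> y" "y \<le> b" for x y
  proof -
    have "Q x - F * x - f x \<le> Q y - F * y - f y"
    proof (rule DERIV_nonneg_imp_nondecreasing[OF \<open>x \<le> y\<close>])
      fix t assume "x \<le> t" "t \<le> y"
      then have t: "\<alpha> \<le> t" "t \<le> \<beta>" using that a b by auto
      have "((\<lambda>x. Q x - F * x - f x) has_real_derivative w t - F - (w t - \<gamma> t)) (at t)"
        by (auto intro!: derivative_eq_intros dQ df t)
      then show "\<exists>y. ((\<lambda>x. Q x - F * x - f x) has_real_derivative y) (at t) \<and> 0 \<le> y"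
        using \<gamma>[OF t] by (intro exI conjI) auto
    qed
    then show ?thesis by (simp add: algebra_simps)
  qed
  define L1 L2 where "L1 = x0 - a" and "L2 = b - x0"
  have L: "0 < L1" "0 < L2" using a b by (auto simp: L1_def L2_def)
  \<comment> \<open>Integrates \<open>f t \<ge> f x0 - B1 + F * (x0 - t)\<close> over
    \<open>[a, x0]\<close>; \<open>right\<close> is the mirror estimate.\<close>
  have left: "(f x0 - B1) * L1 + F * L1\<^sup>2 / 2 \<le> u x0 - u a"
  proof -
    have "u a - (f x0 - B1) * a + F * (x0 - a)\<^sup>2 / 2 \<le> u x0 - (f x0 - B1) * x0 + F * (x0 - x0)\<^sup>2 / 2"
    proof (rule DERIV_nonneg_imp_nondecreasing[of a x0 "\<lambda>x. u x - (f x0 - B1) * x + F * (x0 - x)\<^sup>2 / 2"])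
      fix t assume t: "a \<le> t" "t \<le> x0"
      have "((\<lambda>x. u x - (f x0 - B1) * x + F * (x0 - x)\<^sup>2 / 2) has_real_derivative f t - (f x0 - B1) - F * (x0 - t)) (at t)"
        using t a x0 by (auto intro!: derivative_eq_intros du simp: field_simps)
      then show "\<exists>y. ((\<lambda>x. u x - (f x0 - B1) * x + F * (x0 - x)\<^sup>2 / 2) has_real_derivative y) (at t) \<and> 0 \<le> y"
        using drop[of t x0] Qmono[of a t] t b by (intro exI conjI) (auto simp: B1_def)
    qed (use a in simp)
    then show ?thesis by (simp add: L1_def algebra_simps)
  qed
  have right: "u b - u x0 \<le> (f x0 + B2) * L2 - F * L2\<^sup>2 / 2"
  proof -
    have "(f x0 + B2) * x0 - F * (x0 - x0)\<^sup>2 / 2 - u x0 \<le> (f x0 + B2) * b - F * (b - x0)\<^sup>2 / 2 - u b"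
    proof (rule DERIV_nonneg_imp_nondecreasing[of x0 b "\<lambda>x. (f x0 + B2) * x - F * (x - x0)\<^sup>2 / 2 - u x"])
      fix t assume t: "x0 \<le> t" "t \<le> b"
      have "((\<lambda>x. (f x0 + B2) * x - F * (x - x0)\<^sup>2 / 2 - u x) has_real_derivative (f x0 + B2) - F * (t - x0) - f t) (at t)"
        using t b x0 by (auto intro!: derivative_eq_intros du simp: field_simps)
      then show "\<exists>y. ((\<lambda>x. (f x0 + B2) * x - F * (x - x0)\<^sup>2 / 2 - u x) has_real_derivative y) (at t) \<and> 0 \<le> y"
        using drop[of x0 t] Qmono[of t b] t a by (intro exI conjI) (auto simp: B2_def)
    qed (use b in simp)
    then show ?thesis by (simp add: L2_def algebra_simps)
  qed
  define ta tb where "ta = a - \<alpha>" and "tb = \<beta> - b"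
  have t: "0 \<le> ta" "0 \<le> tb" using a b by (auto simp: ta_def tb_def)
  \<comment> \<open>Dividing the two estimates by \<open>L1\<close> and \<open>L2\<close> and adding
    them cancels \<open>f x0\<close>. The heights \<open>M * ta\<close> and \<open>M * tb\<close>
    gained on the trimmed pieces enter as extra force.\<close>
  have force: "F * (L1 + L2) / 2 - 2 + (M - 1) * (ta / L1 + tb / L2) \<le> B1 + B2"
  proof -
    have "(f x0 - B1 + F * L1 / 2) * L1 \<le> u x0 - M * ta"
      using left a by (simp add: ta_def algebra_simps power2_eq_square)
    also have "\<dots> \<le> L1 - (M - 1) * ta" using u by (simp add: L1_def ta_def algebra_simps)
    also have "\<dots> = (1 - (M - 1) * (ta / L1)) * L1" using L by (simp add: field_simps)
    finally have 1: "f x0 - B1 + F * L1 / 2 \<le> 1 - (M - 1) * (ta / L1)" using L by simp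
    have "(- f x0 - B2 + F * L2 / 2) * L2 \<le> u x0 - M * tb"
      using right b by (simp add: tb_def algebra_simps power2_eq_square)
    also have "\<dots> \<le> L2 - (M - 1) * tb" using u by (simp add: L2_def tb_def algebra_simps)
    also have "\<dots> = (1 - (M - 1) * (tb / L2)) * L2" using L by (simp add: field_simps)
    finally have 2: "- f x0 - B2 + F * L2 / 2 \<le> 1 - (M - 1) * (tb / L2)" using L by simp
    show ?thesis using 1 2 by (simp add: algebra_simps add_divide_distrib)
  qed
  \<comment> \<open>Either the trimmed pieces are long relative to \<open>L1\<close>,
    \<open>L2\<close> and their climb forces \<open>M - 3\<close>, or at least half of
    \<open>[\<alpha>, \<beta>]\<close> remains.\<close>
  have B_ge: "min (M - 3) (F * (\<beta> - \<alpha>) / 4 - 2) \<le> B1 + B2"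
  proof -
    have r: "0 \<le> ta / L1" "0 \<le> tb / L2" "0 \<le> F * (L1 + L2) / 2" using t L \<open>0 < F\<close> by auto
    show ?thesis
    proof (cases "1 \<le> ta / L1 + tb / L2")
      case True
      then have "(M - 1) * 1 \<le> (M - 1) * (ta / L1 + tb / L2)" using \<open>1 \<le> M\<close> by (intro mult_left_mono) auto
      then show ?thesis using force r by simp
    next
      case False
      then have "ta / L1 \<le> 1" "tb / L2 \<le> 1" using r by auto
      then have "ta \<le> L1" "tb \<le> L2" using L by auto
      then have "F * ((\<beta> - \<alpha>) / 2) \<le> F * (L1 + L2)"
        using \<open>0 < F\<close> by (intro mult_left_mono) (auto simp: ta_def tb_def L1_def L2_def)
      moreover have "0 \<le> (M - 1) * (ta / L1 + tb / L2)" using r \<open>1 \<le> M\<close> by simp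
      ultimately show ?thesis using force by simp
    qed
  qed
  \<comment> \<open>Some point \<open>z\<close> right of \<open>x0\<close> has slope at least -1,
    since \<open>u b \<ge> tb\<close>; from \<open>x\<close> to \<open>z\<close> the slope rises by
    at most the obstacle force.\<close>
  have f_ge: "- (1 + (B1 + B2)) \<le> f x" if x: "a \<le> x" "x \<le> x0" for x
  proof -
    obtain z where z: "x0 < z" "z < b" "u b - u x0 = (b - x0) * f z"
      using MVT2[of x0 b u f] du b x0 by auto
    have "f z \<le> f x + (B1 + B2)"
    proof -
      have "0 \<le> F * (z - x)" using \<open>0 < F\<close> x z by simp
      then show ?thesis using drop[of x z] Qmono[of a x] Qmono[of z b] x z by (simp flip: B)
    qed
    moreover have "- 1 \<le> f z"
    proof -
      have "tb * 1 \<le> tb * M" using t \<open>1 \<le> M\<close> by (intro mult_left_mono) auto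
      then have "(b - x0) * (- 1) \<le> (b - x0) * f z"
        unfolding z(3)[symmetric] using b u by (simp add: tb_def algebra_simps)
      then show ?thesis using b by (subst (asm) mult_le_cancel_left_pos) auto
    qed
    ultimately show ?thesis by simp
  qed
  have "u a \<le> (\<beta> - \<alpha>) * (2 + (B1 + B2))"
  proof -
    obtain z where z: "a < z" "z < x0" "u x0 - u a = (x0 - a) * f z"
      using MVT2[of a x0 u f] du a x0 by auto
    have B0: "0 \<le> B1 + B2" using Qmono[of a b] a b B by simp
    have "(x0 - a) * - (1 + (B1 + B2)) \<le> (x0 - a) * f z" using f_ge[of z] z a by (intro mult_left_mono) auto
    then have "u a \<le> u x0 + (x0 - a) * (1 + (B1 + B2))" using z by (simp add: algebra_simps)
    also have "\<dots> \<le> (\<beta> - \<alpha>) * 1 + (\<beta> - \<alpha>) * (1 + (B1 + B2))"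
      using u x0 a B0 by (intro add_mono mult_right_mono) auto
    finally show ?thesis by (simp add: algebra_simps)
  qed
  then show ?thesis
    using a b f_ge[of a] B_ge by (intro exI[of _ a] exI[of _ b]) (auto simp: B)
qed

section \<open>From a solution below the tent to a large path sum\<close>

text \<open>As \<open>\<delta> < 1/2\<close>, each bump lives strictly inside its own unit cell. On
  a column edge both sides vanish, so the formula holds for either neighbouring column.\<close>

lemma obstacle_sum_eq:
  fixes \<phi> :: "real \<times> real \<Rightarrow> real" and L :: "int \<times> int \<Rightarrow> real"
  assumes "\<delta> < 1/2" and supp: "\<And>x s. \<phi> (x, s) \<noteq> 0 \<Longrightarrow> \<bar>x\<bar> \<le> \<delta> \<and> \<bar>s\<bar> \<le> \<delta>"
    and x: "\<bar>x - of_int i\<bar> \<le> 1/2"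
  shows "(\<Sum>\<^sub>\<infinity>ij\<in>UNIV. L ij * \<phi> (x - of_int (fst ij), s - (of_int (snd ij) + 1/2)))
    = L (i, \<lfloor>s\<rfloor>) * \<phi> (x - of_int i, s - (of_int \<lfloor>s\<rfloor> + 1/2))"
proof -
  have "L ij * \<phi> (x - of_int (fst ij), s - (of_int (snd ij) + 1/2)) = 0" if "ij \<noteq> (i, \<lfloor>s\<rfloor>)" for ij
  proof (rule ccontr)
    assume "\<not> ?thesis"
    then have "\<bar>x - of_int (fst ij)\<bar> \<le> \<delta>" "\<bar>s - (of_int (snd ij) + 1/2)\<bar> \<le> \<delta>"
      using supp by force+
    then have "\<bar>x - of_int (fst ij)\<bar> < 1/2" "\<bar>s - (of_int (snd ij) + 1/2)\<bar> < 1/2"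
      using \<open>\<delta> < 1/2\<close> by auto
    then have "\<bar>real_of_int (fst ij - i)\<bar> < 1" "of_int (snd ij) \<le> s" "s < of_int (snd ij) + 1"
      using x unfolding of_int_diff abs_less_iff abs_le_iff by linarith+
    then have "fst ij = i" "snd ij = \<lfloor>s\<rfloor>"
      by (simp_all add: floor_unique[symmetric] del: of_int_diff)
    then show False using that by (metis prod.collapse)
  qed
  then have "(\<Sum>\<^sub>\<infinity>ij\<in>UNIV. L ij * \<phi> (x - of_int (fst ij), s - (of_int (snd ij) + 1/2)))
     = (\<Sum>\<^sub>\<infinity>ij\<in>{(i, \<lfloor>s\<rfloor>)}. L ij * \<phi> (x - of_int (fst ij), s - (of_int (snd ij) + 1/2)))"
    by (intro infsum_cong_neutral) auto
  then show ?thesis by simp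
qed

text \<open>The deterministic core: for any nonnegative strengths \<open>L\<close>, falling below
  the tent makes the path sum exponentially large in \<open>N\<close>.\<close>

lemma path_sum_ge_of_low_solution:
  fixes v :: "real \<Rightarrow> real" and L :: "int \<times> int \<Rightarrow> real" and N :: nat
  assumes \<delta>: "0 < \<delta>" "\<delta> < 1/2"
    and \<phi>: "\<And>p. 0 \<le> \<phi> p" "\<And>p. \<phi> p \<le> \<Phi>" "0 < \<Phi>"
    and supp: "\<And>x s. \<phi> (x, s) \<noteq> 0 \<Longrightarrow> \<bar>x\<bar> \<le> \<delta> \<and> \<bar>s\<bar> \<le> \<delta>"
    and g: "continuous_on UNIV g" "\<And>p. 0 \<le> g p"
    and L: "\<And>k. 0 \<le> L k"
    and sol: "dirichlet_sol (\<lambda>x s. g (x, s) - (\<Sum>\<^sub>\<infinity>ij\<in>UNIV. L ij * \<phi> (x - of_int (fst ij), s - (of_int (snd ij) + 1/2))))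
           F (- real N + \<delta>) (real N - \<delta>) v"
    and v0: "\<And>x. - real N + \<delta> \<le> x \<Longrightarrow> x \<le> real N - \<delta> \<Longrightarrow> 0 \<le> v x"
    and low: "- real N + \<delta> \<le> x0" "x0 \<le> real N - \<delta>" "v x0 < real N - 1 - \<bar>x0\<bar>"
    and "16 \<le> F" "1 \<le> N" "0 < \<theta>" and \<kappa>: "\<kappa> = \<theta> / (2 * pi * \<Phi>)" and e: "0 < e" "e \<le> 1" "e \<le> \<kappa> / 296"
  shows "ennreal (exp ((\<kappa> * F / 32 - (102 - 10 * ln e)) * real N)) \<le> path_sum L \<theta> (2 * N - 1) (1 - int N) 0"
proof -
  define w where "w x = (\<Sum>\<^sub>\<infinity>ij\<in>UNIV. L ij * \<phi> (x - of_int (fst ij), v x - (of_int (snd ij) + 1/2)))" for x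
  define \<gamma> where "\<gamma> x = F + g (x, v x)" for x
  obtain f f' where cv: "continuous_on {- real N + \<delta>..real N - \<delta>} v"
    and sol': "\<And>x. x \<in> {- real N + \<delta><..<real N - \<delta>} \<Longrightarrow> (v has_real_derivative f x) (at x) \<and>
        (f has_real_derivative f' x) (at x) \<and> f' x + (g (x, v x) - w x) + F = 0"
    using sol unfolding dirichlet_sol_def w_def by blast
  \<comment> \<open>Keeps exactly the \<open>2 * N - 1\<close> full columns centred at
    \<open>1 - N\<close> up to \<open>N - 1\<close>.\<close>
  define \<alpha> \<beta> where "\<alpha> = - real N + 1/2" and "\<beta> = real N - 1/2"
  define n where "n = 2 * N - 1"
  have n: "real n = 2 * real N - 1" using \<open>1 \<le> N\<close> by (simp add: n_def)
  have N: "1 \<le> real N" using \<open>1 \<le> N\<close> by simp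
  have inside: "x \<in> {- real N + \<delta><..<real N - \<delta>}" if "\<alpha> \<le> x" "x \<le> \<beta>" for x
    using that \<delta> by (simp add: \<alpha>_def \<beta>_def)
  have du: "(v has_real_derivative f x) (at x)" if "\<alpha> \<le> x" "x \<le> \<beta>" for x
    using sol'[OF inside[OF that]] by blast
  have df: "(f has_real_derivative w x - \<gamma> x) (at x)" if "\<alpha> \<le> x" "x \<le> \<beta>" for x
  proof -
    have "f' x = w x - \<gamma> x" using sol'[OF inside[OF that]] by (simp add: \<gamma>_def)
    then show ?thesis using sol'[OF inside[OF that]] by metis
  qed
  have w: "0 \<le> w x \<and> w x \<le> \<Phi> * L (1 - int N + int k, \<lfloor>v x\<rfloor>)"
    if "\<alpha> + real k \<le> x" "x \<le> \<alpha> + real k + 1" for k x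
  proof -
    have "\<bar>x - of_int (1 - int N + int k)\<bar> \<le> 1/2"
      using that unfolding \<alpha>_def of_int_diff of_int_add abs_le_iff by simp
    from obstacle_sum_eq[where L = L and s = "v x", OF \<delta>(2) supp this]
    have "w x = L (1 - int N + int k, \<lfloor>v x\<rfloor>) * \<phi> (x - of_int (1 - int N + int k), v x - (of_int \<lfloor>v x\<rfloor> + 1/2))"
      unfolding w_def by blast
    then show ?thesis using \<phi> L by (simp add: mult.commute[of \<Phi>] mult_left_mono)
  qed
  have w0: "0 \<le> w x" if "\<alpha> \<le> x" "x \<le> \<beta>" for x
    using w[of "nat \<lfloor>x - \<alpha>\<rfloor>" x] that by (simp; linarith)
  define I where "I x = integral {- real N + \<delta>..x} (\<lambda>t. g (t, v t))" for x
  have cg: "continuous_on {- real N + \<delta>..real N - \<delta>} (\<lambda>t. g (t, v t))"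
    by (intro continuous_on_compose2[OF g(1)] continuous_intros cv) auto
  have dI: "(I has_real_derivative g (x, v x)) (at x)" if "\<alpha> \<le> x" "x \<le> \<beta>" for x
    using integral_has_real_derivative[OF cg, of x] inside[OF that]
    unfolding I_def by (auto simp: at_within_Icc_at)
  \<comment> \<open>Read off the equation, so that \<open>Q' = w\<close> without integrating
    \<open>w\<close>.\<close>
  define Q where "Q x = f x + F * x + I x" for x
  have dQ: "(Q has_real_derivative w x) (at x)" if "\<alpha> \<le> x" "x \<le> \<beta>" for x
    unfolding Q_def by (auto intro!: derivative_eq_intros df dI that simp: \<gamma>_def)
  \<comment> \<open>\<open>W' = w + \<gamma>\<close> dominates
    \<open>\<bar>f'\<bar> = \<bar>w - \<gamma>\<bar>\<close>.\<close>
  define W where "W x = 2 * Q x - f x" for x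
  have Qmono: "Q x \<le> Q y" if "\<alpha> \<le> x" "x \<le> y" "y \<le> \<beta>" for x y
    by (rule DERIV_nonneg_imp_nondecreasing[OF that(2)]) (use dQ w0 that in \<open>meson order.trans\<close>)
  have dW: "\<bar>f y - f x\<bar> \<le> W y - W x" if "\<alpha> \<le> x" "x \<le> y" "y \<le> \<beta>" for x y
  proof -
    have "Q x - f x \<le> Q y - f y"
    proof (rule DERIV_nonneg_imp_nondecreasing[OF that(2)])
      fix t assume "x \<le> t" "t \<le> y"
      then have t: "\<alpha> \<le> t" "t \<le> \<beta>" using that by auto
      have "((\<lambda>x. Q x - f x) has_real_derivative \<gamma> t) (at t)"
        by (auto intro!: derivative_eq_intros dQ df t)
      moreover have "0 \<le> \<gamma> t" using g(2) \<open>16 \<le> F\<close> by (simp add: \<gamma>_def add_nonneg_nonneg)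
      ultimately show "\<exists>y. ((\<lambda>x. Q x - f x) has_real_derivative y) (at t) \<and> 0 \<le> y" by blast
    qed
    then show ?thesis using Qmono[OF that] unfolding W_def by linarith
  qed
  have x0: "\<alpha> < x0" "x0 < \<beta>" "v x0 < x0 - \<alpha>" "v x0 < \<beta> - x0"
    using low v0[OF low(1,2)] by (auto simp: \<alpha>_def \<beta>_def)
  \<comment> \<open>With this choice both alternatives in the force bound are at least
    \<open>M / 8\<close>.\<close>
  define M where "M = F * real N"
  have M: "16 \<le> M" using mult_mono[of 16 F 1 "real N"] \<open>16 \<le> F\<close> N by (simp add: M_def)
  have "\<exists>a b. \<alpha> \<le> a \<and> a \<le> b \<and> b \<le> \<beta> \<and> min (M - 3) (F * (\<beta> - \<alpha>) / 4 - 2) \<le> Q b - Q a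
    \<and> - (1 + (Q b - Q a)) \<le> f a \<and> f a \<le> M \<and> - M \<le> f b \<and> v a \<le> (\<beta> - \<alpha>) * (2 + (Q b - Q a))"
    using x0 \<delta> N \<open>16 \<le> F\<close> M g(2)
    by (intro obstacle_force_lower_bound[OF x0(1,2) du df dQ w0]) (auto simp: \<gamma>_def \<alpha>_def \<beta>_def intro!: v0)
  then obtain a b where ab: "\<alpha> \<le> a" "a \<le> b" "b \<le> \<beta>"
    and B0: "min (M - 3) (F * (\<beta> - \<alpha>) / 4 - 2) \<le> Q b - Q a"
    and fa: "- (1 + (Q b - Q a)) \<le> f a" "f a \<le> M" and fb: "- M \<le> f b"
    and va: "v a \<le> (\<beta> - \<alpha>) * (2 + (Q b - Q a))" by blast
  define B where "B = Q b - Q a"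
  have B: "M / 8 \<le> B"
  proof -
    have "F * real N \<le> F * (\<beta> - \<alpha>)" using N \<open>16 \<le> F\<close> by (intro mult_left_mono) (auto simp: \<alpha>_def \<beta>_def)
    then show ?thesis using B0 M unfolding B_def M_def[symmetric] by simp
  qed
  then have "2 \<le> B" using M by simp
  have "ennreal (exp (\<kappa> / 2 * (Q b - Q a) - (36 - 4 * ln e) * real n - 4 * e * (W b - W a)
            - 2 * ln (2 + \<bar>v a\<bar> + \<bar>f a\<bar>)))
    \<le> path_sum L \<theta> n (1 - int N) 0"
  proof (rule path_sum_lower_bound[where \<alpha> = \<alpha> and w = w and \<Phi> = \<Phi>])
    show "b \<le> \<alpha> + real n" using ab by (simp add: n \<alpha>_def \<beta>_def)
  qed (use ab L \<open>0 < \<theta>\<close> \<kappa> e \<phi>(3) in \<open>auto intro!: du dQ w dW\<close>)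
  \<comment> \<open>Half of \<open>\<kappa> / 2 * B\<close> yields
    \<open>\<kappa> * F * N / 32\<close>. The other half absorbs \<open>72 * e * B\<close> from the
    variation and \<open>2 * e * B\<close> from the initial potential, whence
    \<open>296 = 4 * 74\<close>; the constants are \<open>102 = 72 + 30\<close> and
    \<open>10 = 8 + 2\<close>.\<close>
  moreover have "(\<kappa> * F / 32 - (102 - 10 * ln e)) * real N \<le>
    \<kappa> / 2 * (Q b - Q a) - (36 - 4 * ln e) * real n - 4 * e * (W b - W a) - 2 * ln (2 + \<bar>v a\<bar> + \<bar>f a\<bar>)"
  proof -
    have lne: "ln e \<le> 0" using e by simp
    have "W b - W a \<le> 18 * B" using fa fb B by (simp add: W_def B_def)
    then have 1: "4 * e * (W b - W a) \<le> 72 * (e * B)" using e by (simp add: mult_left_mono)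
    have 2: "(36 - 4 * ln e) * real n \<le> (72 - 8 * ln e) * real N"
    proof -
      have "(36 - 4 * ln e) * real n \<le> (36 - 4 * ln e) * (2 * real N)"
        using lne by (intro mult_left_mono) (auto simp: n)
      then show ?thesis by (simp add: algebra_simps)
    qed
    have 3: "2 * ln (2 + \<bar>v a\<bar> + \<bar>f a\<bar>) \<le> 30 * real N + 2 * (e * B) - 2 * ln e * real N"
    proof -
      have "0 \<le> v a" using ab \<delta> by (intro v0) (auto simp: \<alpha>_def \<beta>_def)
      moreover have "v a \<le> (2 * real N) * (2 * B)"
        using \<open>2 \<le> B\<close> N by (intro order.trans[OF va] mult_mono) (auto simp: \<alpha>_def \<beta>_def B_def)
      moreover have "\<bar>f a\<bar> \<le> 10 * B" using fa B \<open>2 \<le> B\<close> unfolding B_def[symmetric] by linarith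
      moreover have "B \<le> real N * B" using N \<open>2 \<le> B\<close> by simp
      moreover have "(2 * real N) * (2 * B) = 4 * (real N * B)" by simp
      ultimately have "2 + \<bar>v a\<bar> + \<bar>f a\<bar> \<le> 15 * (real N * B)" using \<open>2 \<le> B\<close> by linarith
      then have "2 + \<bar>v a\<bar> + \<bar>f a\<bar> \<le> (15 * real N) * B" by simp
      then have "ln (2 + \<bar>v a\<bar> + \<bar>f a\<bar>) \<le> ln ((15 * real N) * B)"
        by (intro ln_mono) (auto intro: add_pos_nonneg)
      also have "\<dots> = ln (15 * real N) + ln B" using N \<open>2 \<le> B\<close> by (intro ln_mult_pos) auto
      also have "ln (15 * real N) \<le> 15 * real N" using N by (intro ln_bound) auto
      also have "ln B \<le> ln (1 + B)" using \<open>2 \<le> B\<close> by (intro ln_mono) auto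
      also have "ln (1 + B) \<le> e * B - ln e" using e \<open>2 \<le> B\<close> by (intro ln_one_plus_le_scaled) auto
      finally have "ln (2 + \<bar>v a\<bar> + \<bar>f a\<bar>) \<le> 15 * real N + (e * B - ln e)" by simp
      moreover have "- ln e \<le> - ln e * real N" using mult_left_mono[of 1 "real N" "- ln e"] N lne by simp
      ultimately show ?thesis by simp
    qed
    have 4: "74 * (e * B) \<le> \<kappa> / 4 * B"
      using mult_right_mono[OF e(3), of B] \<open>2 \<le> B\<close> by simp
    have "0 < \<kappa>" using \<kappa> \<open>0 < \<theta>\<close> \<phi>(3) by simp
    then have 5: "\<kappa> / 4 * (M / 8) \<le> \<kappa> / 4 * B" using B by (intro mult_left_mono) auto
    have 6: "(\<kappa> * F / 32 - (102 - 10 * ln e)) * real N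
       = \<kappa> / 4 * (M / 8) - (72 - 8 * ln e) * real N - 30 * real N + 2 * ln e * real N"
      by (simp add: M_def algebra_simps)
    have 7: "\<kappa> / 2 * B = \<kappa> / 4 * B + \<kappa> / 4 * B" by simp
    show ?thesis unfolding 6 B_def[symmetric] 7 using 1 2 3 4 5 by linarith
  qed
  ultimately show ?thesis
    unfolding n_def[symmetric] by (meson order.trans ennreal_leI exp_le_cancel_iff)
qed

section \<open>The probability estimate\<close>

lemma bounded_of_compact_support:
  fixes \<phi> :: "real \<times> real \<Rightarrow> real"
  assumes "continuous_on UNIV \<phi>" and supp: "\<And>x s. \<phi> (x, s) \<noteq> 0 \<Longrightarrow> \<bar>x\<bar> \<le> \<delta> \<and> \<bar>s\<bar> \<le> \<delta>"
  shows "\<exists>B>0. \<forall>p. \<phi> p \<le> B"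
proof -
  let ?K = "cbox (- \<delta>, - \<delta>) (\<delta>, \<delta>)"
  have "compact (\<phi> ` ?K)" using assms(1) by (intro compact_continuous_image continuous_on_subset[OF assms(1)]) auto
  then obtain B where B: "0 < B" "\<And>y. y \<in> \<phi> ` ?K \<Longrightarrow> norm y \<le> B"
    using compact_imp_bounded bounded_pos by metis
  have "\<phi> (x, s) \<le> B" for x s
  proof (cases "\<phi> (x, s) = 0")
    case False
    then have "(x, s) \<in> ?K" using supp[of x s] by (auto simp: cbox_Pair_eq)
    then show ?thesis using B(2)[of "\<phi> (x, s)"] by auto
  qed (use B(1) in simp)
  then show ?thesis using B(1) by auto
qed

text \<open>By continuity and density of the rationals; it reduces the good event to countably many
  conditions, which gives its measurability.\<close>

lemma exists_rat_less:
  fixes h v :: "real \<Rightarrow> real"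
  assumes "a < b" "continuous_on {a..b} h" "continuous_on {a..b} v" "x \<in> {a..b}" "v x < h x"
  shows "\<exists>q. real_of_rat q \<in> {a..b} \<and> v (real_of_rat q) < h (real_of_rat q)"
proof (rule ccontr)
  assume neg: "\<not> ?thesis"
  have dense: "{a<..<b} \<subseteq> closure \<rat>"
  proof
    fix y :: real assume "y \<in> {a<..<b}"
    show "y \<in> closure \<rat>"
      unfolding closure_approachable
    proof (intro allI impI)
      fix d :: real assume "0 < d"
      then obtain r where "r \<in> \<rat>" "y < r" "r < y + d" using Rats_dense_in_real[of y "y + d"] by auto
      then show "\<exists>r\<in>\<rat>. dist r y < d" by (intro bexI[of _ r]) (auto simp: dist_real_def)
    qed
  qed
  have cl: "closure ({a<..<b} \<inter> \<rat>) = {a..b}"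
    using closure_open_Int_superset[OF _ dense] \<open>a < b\<close> by simp
  have "0 \<le> v x - h x"
  proof (rule continuous_ge_on_closure[of "{a<..<b} \<inter> \<rat>" "\<lambda>x. v x - h x" x])
    show "0 \<le> v y - h y" if y: "y \<in> {a<..<b} \<inter> \<rat>" for y
    proof -
      obtain q where "y = real_of_rat q" using y by (auto elim: Rats_cases)
      then show ?thesis using neg y by (auto simp: not_less)
    qed
  qed (use assms cl in \<open>auto intro!: continuous_intros\<close>)
  then show False using assms by simp
qed

theorem mainTheorem1:
  fixes M :: "'w measure" and l :: "int \<times> int \<Rightarrow> 'w \<Rightarrow> real"
    and \<delta> lambda0 :: real and \<phi> g :: "real \<times> real \<Rightarrow> real"
  assumes "prob_space M"
    and "0 < \<delta>" and "\<delta> < 1/2" and "0 < lambda0"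
    and "smooth2 \<phi>" and "\<forall>p. 0 \<le> \<phi> p"
    and "\<forall>x s. \<phi> (x, s) \<noteq> 0 \<longrightarrow> \<bar>x\<bar> \<le> \<delta> \<and> \<bar>s\<bar> \<le> \<delta>"
    and "prob_space.indep_vars M (\<lambda>_. borel) l UNIV"
    and "\<forall>ij. distributed M lborel (l ij) (exponential_density lambda0)"
    and "C1_plane g" and "\<forall>p. 0 \<le> g p"
    and "AE \<omega> in M. ((\<lambda>L. integral (cbox (-L, -L) (L, L)) (\<lambda>p. rfield g \<phi> l (fst p) (snd p) \<omega>)
                          / (2 * L)\<^sup>2) \<longlongrightarrow> 0) at_top"
  shows "\<exists>F0>0. \<exists>C>0. \<exists>K>0. \<forall>F>F0. \<exists>N0::nat. \<forall>N\<ge>N0.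
           \<forall>u :: 'w \<Rightarrow> real \<Rightarrow> real.
             (\<forall>\<omega>\<in>space M.
                 dirichlet_sol (\<lambda>x s. rfield g \<phi> l x s \<omega>) F (- real N + \<delta>) (real N - \<delta>) (u \<omega>)
               \<and> (\<forall>x\<in>{- real N + \<delta> .. real N - \<delta>}. 0 \<le> u \<omega> x))
           \<and> (\<forall>x\<in>{- real N + \<delta> .. real N - \<delta>}. (\<lambda>\<omega>. u \<omega> x) \<in> borel_measurable M)
           \<longrightarrow> measure M {\<omega> \<in> space M. \<forall>x\<in>{- real N + \<delta> .. real N - \<delta>}.
                   max (K * (real N - 1) - K * \<bar>x\<bar>) 0 \<le> u \<omega> x}
               \<ge> 1 - C * exp (- real N / C)"
proof -
  interpret prob_space M by fact
  note ind = assms(8) and D = assms(9)[rule_format]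
  have lm[measurable]: "l k \<in> borel_measurable M" for k
    using D[of k] by (auto simp: distributed_def)
  have supp: "\<And>x s. \<phi> (x, s) \<noteq> 0 \<Longrightarrow> \<bar>x\<bar> \<le> \<delta> \<and> \<bar>s\<bar> \<le> \<delta>" using assms(7) by blast
  have "continuous_on UNIV \<phi>" using assms(5) unfolding smooth2_def by blast
  from bounded_of_compact_support[OF this supp]
  obtain \<Phi> where \<Phi>: "0 < \<Phi>" "\<And>p. \<phi> p \<le> \<Phi>" by blast
  have cg: "continuous_on UNIV g"
    using assms(10) unfolding C1_plane_def
    by (meson continuous_at_imp_continuous_on has_derivative_continuous)
  \<comment> \<open>The deterministic estimate requires nonnegative strengths; this holds off a null
    set \<open>Z\<close>.\<close>
  have "AE \<omega> in M. \<forall>k. 0 \<le> l k \<omega>"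
    unfolding AE_all_countable
    by (intro allI iffD2[OF distributed_AE2[OF D]]) (auto simp: exponential_density_def)
  then obtain Z where Z: "Z \<in> null_sets M" "{\<omega> \<in> space M. \<not> (\<forall>k. 0 \<le> l k \<omega>)} \<subseteq> Z"
    by (auto simp: eventually_ae_filter)
  define \<theta> where "\<theta> = lambda0 / 2"
  define \<kappa> where "\<kappa> = \<theta> / (2 * pi * \<Phi>)"
  define e where "e = min 1 (\<kappa> / 296)"
  define A where "A = 2 * inverse_square_sum"
  have "0 < \<theta>" "0 < \<kappa>" using assms(4) \<Phi>(1) by (auto simp: \<theta>_def \<kappa>_def)
  then have e: "0 < e" "e \<le> 1" "e \<le> \<kappa> / 296" by (auto simp: e_def)
  have A: "1 \<le> A" using inverse_square_sum_ge_1 by (simp add: A_def)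
  \<comment> \<open>Makes the exponent per unit of \<open>N\<close> at least
    \<open>1 + 2 * ln A\<close>: the term \<open>2 * ln A\<close> offsets the expected path sum, and
    1 remains as decay rate.\<close>
  define F0 where "F0 = max 16 (32 / \<kappa> * ((102 - 10 * ln e) + (1 + 2 * ln A)))"
  have main: "1 - 1 * exp (- real N / 1) \<le> prob {\<omega> \<in> space M. \<forall>x\<in>{- real N + \<delta> .. real N - \<delta>}.
                   max (1 * (real N - 1) - 1 * \<bar>x\<bar>) 0 \<le> u \<omega> x}"
    if F: "F0 < F" and N: "1 \<le> N"
      and sol: "\<And>\<omega>. \<omega> \<in> space M \<Longrightarrow>
        dirichlet_sol (\<lambda>x s. rfield g \<phi> l x s \<omega>) F (- real N + \<delta>) (real N - \<delta>) (u \<omega>)"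
      and u0: "\<And>\<omega> x. \<omega> \<in> space M \<Longrightarrow> x \<in> {- real N + \<delta> .. real N - \<delta>} \<Longrightarrow> 0 \<le> u \<omega> x"
      and um: "\<And>x. x \<in> {- real N + \<delta> .. real N - \<delta>} \<Longrightarrow> (\<lambda>\<omega>. u \<omega> x) \<in> borel_measurable M"
    for F N and u :: "'w \<Rightarrow> real \<Rightarrow> real"
  proof -
    define J where "J = {- real N + \<delta> .. real N - \<delta>}"
    define h where "h x = max (1 * (real N - 1) - 1 * \<bar>x\<bar>) 0" for x :: real
    define G where "G = {\<omega> \<in> space M. \<forall>x\<in>J. h x \<le> u \<omega> x}"
    define z where "z = (1 + 2 * ln A) * real N"
    define bad where "bad = {\<omega> \<in> space M. ennreal (exp z) \<le> path_sum (\<lambda>k. l k \<omega>) (lambda0 / 2) (2 * N - 1) (1 - int N) 0}"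
    have J: "- real N + \<delta> < real N - \<delta>" using N assms(3) by simp
    have [measurable]: "bad \<in> events"
      unfolding bad_def using path_sum_measurable[OF lm] by measurable
    have "G = {\<omega> \<in> space M. \<forall>q. real_of_rat q \<in> J \<longrightarrow> h (real_of_rat q) \<le> u \<omega> (real_of_rat q)}"
    proof -
      have "\<forall>x\<in>J. h x \<le> u \<omega> x"
        if \<omega>: "\<omega> \<in> space M" and q: "\<forall>q. real_of_rat q \<in> J \<longrightarrow> h (real_of_rat q) \<le> u \<omega> (real_of_rat q)" for \<omega>
      proof (rule ccontr)
        assume "\<not> ?thesis"
        then obtain x where "x \<in> J" "u \<omega> x < h x" by force
        moreover have "continuous_on J (u \<omega>)" using sol[OF \<omega>] by (simp add: dirichlet_sol_def J_def)
        moreover have "continuous_on J h" unfolding h_def by (intro continuous_intros)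
        ultimately show False
          using exists_rat_less[OF J, of h "u \<omega>" x] q unfolding J_def by (auto simp: not_less[symmetric])
      qed
      then show ?thesis unfolding G_def by auto
    qed
    also have "\<dots> \<in> events"
    proof (intro sets.sets_Collect_countable_All)
      fix q
      show "{\<omega> \<in> space M. real_of_rat q \<in> J \<longrightarrow> h (real_of_rat q) \<le> u \<omega> (real_of_rat q)} \<in> events"
      proof (cases "real_of_rat q \<in> J")
        case True
        note [measurable] = um[OF True[unfolded J_def]]
        show ?thesis using True by simp
      qed simp
    qed
    finally have [measurable]: "G \<in> events" .
    have cover: "space M - Z \<subseteq> G \<union> bad"
    proof
      fix \<omega> assume "\<omega> \<in> space M - Z"
      then have \<omega>: "\<omega> \<in> space M" and L: "\<And>k. 0 \<le> l k \<omega>" using Z(2) by auto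
      show "\<omega> \<in> G \<union> bad"
      proof (cases "\<omega> \<in> G")
        case False
        then obtain x0 where x0: "x0 \<in> J" "u \<omega> x0 < h x0" using \<omega> by (force simp: G_def)
        then have low: "u \<omega> x0 < real N - 1 - \<bar>x0\<bar>"
          using u0[OF \<omega>, of x0] by (auto simp: h_def J_def max_def split: if_splits)
        have "ennreal (exp ((\<kappa> * F / 32 - (102 - 10 * ln e)) * real N))
            \<le> path_sum (\<lambda>k. l k \<omega>) \<theta> (2 * N - 1) (1 - int N) 0"
        proof (rule path_sum_ge_of_low_solution[where \<phi> = \<phi> and g = g and \<Phi> = \<Phi> and F = F and v = "u \<omega>" and ?x0.0 = x0
              and \<delta> = \<delta> and \<kappa> = \<kappa>])
          show "dirichlet_sol (\<lambda>x s. g (x, s) - (\<Sum>\<^sub>\<infinity>ij. l ij \<omega> *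
                  \<phi> (x - of_int (fst ij), s - (of_int (snd ij) + 1/2)))) F (- real N + \<delta>) (real N - \<delta>) (u \<omega>)"
            using sol[OF \<omega>] unfolding rfield_def .
        qed (use assms supp \<Phi> cg L low x0 F N e \<open>0 < \<theta>\<close> u0[OF \<omega>] in \<open>auto simp: J_def F0_def \<kappa>_def\<close>)
        moreover have "z \<le> (\<kappa> * F / 32 - (102 - 10 * ln e)) * real N"
          unfolding z_def
        proof (rule mult_right_mono)
          have "32 / \<kappa> * ((102 - 10 * ln e) + (1 + 2 * ln A)) \<le> F" using F by (simp add: F0_def)
          then have "\<kappa> / 32 * (32 / \<kappa> * ((102 - 10 * ln e) + (1 + 2 * ln A))) \<le> \<kappa> / 32 * F"
            using \<open>0 < \<kappa>\<close> by (intro mult_left_mono) auto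
          then show "1 + 2 * ln A \<le> \<kappa> * F / 32 - (102 - 10 * ln e)" using \<open>0 < \<kappa>\<close> by simp
        qed simp
        ultimately have "ennreal (exp z) \<le> path_sum (\<lambda>k. l k \<omega>) \<theta> (2 * N - 1) (1 - int N) 0"
          by (meson order.trans ennreal_leI exp_le_cancel_iff)
        then show ?thesis using \<omega> by (simp add: bad_def \<theta>_def)
      qed simp
    qed
    have "1 = prob (space M - Z)"
      using prob_space measure_Diff_null_set[OF sets.top Z(1)] by simp
    also have "\<dots> \<le> prob (G \<union> bad)" by (intro finite_measure_mono cover) measurable
    also have "\<dots> \<le> prob G + prob bad" by (intro measure_Un_le) measurable
    also have "prob bad \<le> exp (- z) * A ^ (2 * N - 1)"
      unfolding bad_def A_def by (rule path_sum_tail[OF assms(4) ind D])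
    \<comment> \<open>Raising the power to \<open>2 * N\<close> makes it cancel exactly against
      \<open>z\<close>.\<close>
    also have "\<dots> \<le> exp (- z) * A ^ (2 * N)"
      using A by (intro mult_left_mono power_increasing) auto
    also have "A ^ (2 * N) = exp (2 * ln A * real N)"
      using exp_of_nat_mult[of "2 * N" "ln A"] A by (simp add: ac_simps)
    also have "exp (- z) * exp (2 * ln A * real N) = exp (- real N)"
      unfolding exp_add[symmetric] by (simp add: z_def algebra_simps)
    finally show ?thesis unfolding G_def J_def h_def by simp
  qed
  have "0 < F0" by (simp add: F0_def)
  show ?thesis
  \<comment> \<open>The witnesses are \<open>C = 1\<close>, \<open>K = 1\<close> and
    \<open>N0 = 1\<close>.\<close>
  proof (rule exI[of _ F0], rule conjI[OF \<open>0 < F0\<close>], rule exI[of _ 1], rule conjI[OF zero_less_one],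
      rule exI[of _ 1], rule conjI[OF zero_less_one], intro allI impI exI[of _ "1 :: nat"])
    fix F :: real and N :: nat and u :: "'w \<Rightarrow> real \<Rightarrow> real"
    assume "F0 < F" "1 \<le> N" and *: "(\<forall>\<omega>\<in>space M.
                 dirichlet_sol (\<lambda>x s. rfield g \<phi> l x s \<omega>) F (- real N + \<delta>) (real N - \<delta>) (u \<omega>)
               \<and> (\<forall>x\<in>{- real N + \<delta> .. real N - \<delta>}. 0 \<le> u \<omega> x))
           \<and> (\<forall>x\<in>{- real N + \<delta> .. real N - \<delta>}. (\<lambda>\<omega>. u \<omega> x) \<in> borel_measurable M)"
    then show "1 - 1 * exp (- real N / 1) \<le> measure M {\<omega> \<in> space M. \<forall>x\<in>{- real N + \<delta> .. real N - \<delta>}.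
                   max (1 * (real N - 1) - 1 * \<bar>x\<bar>) 0 \<le> u \<omega> x}"
      by (intro main) auto
  qed
qed

end
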